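(* Let $k$ be a positive integer. Then: (i) if $k\equiv 0 \pmod 3$, then $\mathrm{GP}(3k+3,k)$ is not strongly distance--balanced; (ii) if $k\not\equiv 0 \pmod 3$, then $\mathrm{GP}(3k+3,k)$ is strongly distance--balanced, or it is isomorphic to $\mathrm{GP}(9,2)$, which is not strongly distance--balanced; (iii) if $k\ge 2$, $k\ne 3$, and $k\equiv 0\pmod 3$, then $\mathrm{GP}(3k-3,k)$ is not strongly distance--balanced; (iv) if $k\ge 2$ and $k\not\equiv 0\pmod 3$, then $\mathrm{GP}(3k-3,k)$ is strongly distance--balanced, or it is isomorphic to $\mathrm{GP}(9,4)\cong\mathrm{GP}(9,2)$, which is not strongly distance--balanced.
   Context: For $n\ge 3$ and $k\in\{1,\dots,n-1\}\setminus\{n/2\}$, the generalized Petersen graph $\mathrm{GP}(n,k)$ has vertex set $\{u_i\mid i\in\mathbb{Z}_n\}\cup\{v_i\mid i\in\mathbb{Z}_n\}$ and edges $u_iu_{i+1}$, $v_iv_{i+k}$, $u_iv_i$ for $i\in\mathbb{Z}_n$. For an edge $uv$ of a graph $X$ and integers $k,l$, $D^k_l(u,v)=\{x\in V(X)\mid d(u,x)=k,\ d(v,x)=l\}$, with $d$ the path-length distance. $X$ is strongly distance--balanced if $|D^{k}_{k-1}(u,v)|=|D^{k-1}_{k}(u,v)|$ for every integer $k$ and every edge $uv$. *)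

theory Defs
  imports "Graph_Theory.Graph_Theory" "HOL-Number_Theory.Cong"
begin

text \<open>
  Undirected simple graphs are symmetric loop-free digraphs (locale \<open>pair_graph\<close>), an edge
  being represented by its two orientations.
\<close>

datatype gp_vertex = U nat | V nat

text \<open>
  \<open>\<int>\<^sub>n\<close> is represented by the residues \<open>{0..<n}\<close>.  The definition is meant for \<open>n \<ge> 3\<close>,
  \<open>1 \<le> k \<le> n - 1\<close> and \<open>2 * k \<noteq> n\<close>.
\<close>

definition GP_edges :: "nat \<Rightarrow> nat \<Rightarrow> gp_vertex rel" where
  "GP_edges n k =
     {(U i, U ((i + 1) mod n)) | i. i < n} \<union>
     {(V i, V ((i + k) mod n)) | i. i < n} \<union>
     {(U i, V i) | i. i < n}"

definition GP :: "nat \<Rightarrow> nat \<Rightarrow> gp_vertex pair_pre_digraph" where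
  "GP n k = \<lparr> pverts = U ` {..<n} \<union> V ` {..<n},
              parcs = GP_edges n k \<union> (GP_edges n k)\<inverse> \<rparr>"

text \<open>
  The constant \<open>\<mu>\<close> is specified only for well-formed digraphs, which every graph considered here is
  (\<open>pair_graph_GP\<close> below); with unit weights it is the least length of a walk.
\<close>

definition graph_dist :: "'a pair_pre_digraph \<Rightarrow> 'a \<Rightarrow> 'a \<Rightarrow> ereal" where
  "graph_dist G u v = wf_digraph.\<mu> (with_proj G) (\<lambda>_. 1) u v"

definition D_set :: "'a pair_pre_digraph \<Rightarrow> int \<Rightarrow> int \<Rightarrow> 'a \<Rightarrow> 'a \<Rightarrow> 'a set" where
  "D_set G k l u v =
     {x \<in> pverts G. graph_dist G u x = ereal (of_int k) \<and> graph_dist G v x = ereal (of_int l)}"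

definition strongly_distance_balanced :: "'a pair_pre_digraph \<Rightarrow> bool" where
  "strongly_distance_balanced G \<longleftrightarrow>
     (\<forall>k. \<forall>(u, v) \<in> parcs G. card (D_set G k (k - 1) u v) = card (D_set G (k - 1) k u v))"

definition graph_iso :: "'a pair_pre_digraph \<Rightarrow> 'b pair_pre_digraph \<Rightarrow> bool" where
  "graph_iso G H \<longleftrightarrow> digraph_iso (with_proj G) (with_proj H)"

lemma add_mod_ne_self:
  fixes i m n :: nat
  assumes "i < n" "0 < m" "m < n"
  shows "(i + m) mod n \<noteq> i"
  using assms by (cases "i + m < n") (auto simp: mod_if)

lemma pair_graph_GP:
  assumes "2 \<le> n" "0 < k" "k < n"
  shows "pair_graph (GP n k)"
proof
  have fin: "finite (GP_edges n k)"
    by (simp add: GP_edges_def)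
  show "finite (parcs (GP n k))" using fin by (simp add: GP_def)
  show "finite (pverts (GP n k))" by (simp add: GP_def)
  show "symmetric (with_proj (GP n k))"
    by (auto simp: symmetric_def GP_def sym_def)
next
  fix e assume e: "e \<in> parcs (GP n k)"
  show "fst e \<in> pverts (GP n k)" "snd e \<in> pverts (GP n k)"
    using e assms by (auto simp: GP_def GP_edges_def)
  show "fst e \<noteq> snd e"
    using e assms add_mod_ne_self[of _ n 1] add_mod_ne_self[of _ n k]
    by (fastforce simp: GP_def GP_edges_def)
qed

end

theory Submission
  imports Defs
begin

text \<open>
  A walk in \<open>GP n k\<close> amounts to a pair \<open>(a, b)\<close> of net step counts along the two rims, plus the spokes
  it uses, so distances depend only on index differences modulo \<open>n\<close>. Telescoping the numbers
  \<open>|D\<^sup>k\<^bsub>k-1\<^esub>| - |D\<^bsup>k-1\<^esup>\<^sub>k|\<close> shows that strong distance-balancedness says that adjacent vertices have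
  spheres of equal sizes, i.e. that the distances inside the outer rim and inside the inner rim have
  the same distribution on \<open>\<int>\<^sub>n\<close>.

  If \<open>k\<^sup>2 = 1\<close> modulo \<open>n\<close>, then \<open>x \<mapsto> k x\<close> carries one distance to the other. If \<open>n = 9 m\<close> and
  \<open>k = 3 m - 1\<close>, it still does so except at four points, which have to be interchanged in pairs when
  \<open>m \<ge> 2\<close>; the case \<open>k = 3 m + 1\<close> follows by exchanging the rims because
  \<open>(3 m - 1) (3 m + 1) = - 1\<close>. If \<open>3\<close> divides \<open>k\<close>, \<open>\<int>\<^sub>n\<close> has an involution \<open>\<phi>\<close> such that the outer
  distance of \<open>\<phi> x\<close> never exceeds the inner distance of \<open>x\<close> and is smaller for some \<open>x\<close>, so the sums
  of the two distances differ.
\<close>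

section \<open>Distances and spheres\<close>

text \<open>The condition \<open>step\<close> makes \<open>d\<close> a lower bound for the length of
  every walk from \<open>u\<close>; following \<open>descent\<close> backwards from \<open>v\<close>
  produces a walk of length at most \<open>d v\<close>.\<close>

lemma graph_dist_eqI:
  fixes d :: "'a \<Rightarrow> nat"
  assumes wf: "wf_digraph (with_proj G)" and u: "u \<in> pverts G" and v: "v \<in> pverts G"
    and start: "d u = 0"
    and step: "\<And>x y. (x, y) \<in> parcs G \<Longrightarrow> d y \<le> d x + 1"
    and descent: "\<And>y. y \<in> pverts G \<Longrightarrow> y \<noteq> u \<Longrightarrow> \<exists>x. (x, y) \<in> parcs G \<and> d x + 1 \<le> d y"
  shows "graph_dist G u v = ereal (real (d v))"
proof -
  interpret wf_digraph "with_proj G" by (rule wf)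
  have lower: "real (d y) \<le> real (d x) + awalk_cost (\<lambda>_. 1) p" if "awalk x p y" for x y p
    using that
  proof (induction p arbitrary: x)
    case Nil
    then show ?case by (simp add: awalk_Nil_iff)
  next
    case (Cons e p)
    then have e: "e \<in> parcs G" "x = fst e" "awalk (snd e) p y"
      by (auto simp: awalk_Cons_iff)
    have "d (snd e) \<le> d x + 1" using step[of "fst e" "snd e"] e by simp
    then show ?case using Cons.IH[OF e(3)] by simp
  qed
  have upper: "\<exists>p. awalk u p y \<and> awalk_cost (\<lambda>_. 1) p \<le> real (d y)" if "y \<in> pverts G" for y
    using that
  proof (induction "d y" arbitrary: y rule: less_induct)
    case less
    show ?case
    proof (cases "y = u")
      case True
      then show ?thesis using u by (intro exI[of _ "[]"]) (simp add: awalk_Nil_iff)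
    next
      case False
      then obtain x where x: "(x, y) \<in> parcs G" "d x + 1 \<le> d y"
        using descent less.prems by blast
      then have "x \<in> pverts G" using wellformed(1)[of "(x, y)"] by simp
      then obtain p where p: "awalk u p x" "awalk_cost (\<lambda>_. 1) p \<le> real (d x)"
        using less.hyps[of x] x(2) by auto
      have "awalk x [(x, y)] y"
        using x(1) less.prems by (simp add: awalk_Cons_iff awalk_Nil_iff)
      then have "awalk u (p @ [(x, y)]) y" using p(1) by (rule awalk_appendI[rotated])
      moreover have "awalk_cost (\<lambda>_. 1) (p @ [(x, y)]) \<le> real (d y)" using p(2) x(2) by simp
      ultimately show ?thesis by blast
    qed
  qed
  obtain p where "awalk u p v" "awalk_cost (\<lambda>_. 1) p \<le> real (d v)" using upper[OF v] by blast
  then have "\<mu> (\<lambda>_. 1) u v \<le> ereal (real (d v))"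
    using min_cost_le_walk_cost[of u p v "\<lambda>_. 1"] by (meson ereal_less_eq(3) order_trans)
  moreover have "ereal (real (d v)) \<le> \<mu> (\<lambda>_. 1) u v"
    unfolding \<mu>_def using lower[of u _ v] start by (intro INF_greatest) auto
  ultimately show ?thesis unfolding graph_dist_def by simp
qed

text \<open>Distances from adjacent vertices differ by at most one, so each sphere splits into three
  sets of the form \<open>D_set\<close>, the middle one being common to both endpoints.\<close>

lemma strongly_distance_balanced_iff_spheres:
  fixes d :: "'a \<Rightarrow> 'a \<Rightarrow> nat"
  assumes fin: "finite (pverts G)"
    and arcs: "\<And>u v. (u, v) \<in> parcs G \<Longrightarrow> u \<in> pverts G \<and> v \<in> pverts G"
    and dist: "\<And>u x. u \<in> pverts G \<Longrightarrow> x \<in> pverts G \<Longrightarrow> graph_dist G u x = ereal (real (d u x))"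
    and near: "\<And>u v x. (u, v) \<in> parcs G \<Longrightarrow> x \<in> pverts G \<Longrightarrow> d u x \<le> d v x + 1 \<and> d v x \<le> d u x + 1"
  shows "strongly_distance_balanced G \<longleftrightarrow>
    (\<forall>(u, v) \<in> parcs G. \<forall>j. card {x \<in> pverts G. d u x = j} = card {x \<in> pverts G. d v x = j})"
proof -
  have "(\<forall>k. card (D_set G k (k - 1) u v) = card (D_set G (k - 1) k u v)) \<longleftrightarrow>
        (\<forall>j. card {x \<in> pverts G. d u x = j} = card {x \<in> pverts G. d v x = j})"
    (is "?L \<longleftrightarrow> ?R") if uv: "(u, v) \<in> parcs G" for u v
  proof -
    have ereal_of_int: "ereal (real m) = ereal (of_int k) \<longleftrightarrow> int m = k" for m k
      by (metis ereal.inject of_int_eq_iff of_int_of_nat_eq)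
    have D: "D_set G k l u v = {x \<in> pverts G. int (d u x) = k \<and> int (d v x) = l}" for k l
      unfolding D_set_def using dist arcs[OF uv] ereal_of_int by auto
    \<comment> \<open>\<open>E k\<close> is the imbalance at level \<open>k\<close>. The spheres at
      level \<open>k\<close> differ in size by \<open>E k - E (k + 1)\<close>, so equal spheres
      force \<open>E\<close> to be constant.\<close>
    define E where "E k = int (card (D_set G k (k - 1) u v)) - int (card (D_set G (k - 1) k u v))" for k
    have su: "{x \<in> pverts G. int (d u x) = k} =
        D_set G k (k - 1) u v \<union> D_set G k k u v \<union> D_set G k (k + 1) u v" for k
      unfolding D using near[OF uv] by fastforce
    have sv: "{x \<in> pverts G. int (d v x) = k} =
        D_set G (k - 1) k u v \<union> D_set G k k u v \<union> D_set G (k + 1) k u v" for k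
      unfolding D using near[OF uv] by fastforce
    have cu: "card {x \<in> pverts G. int (d u x) = k} =
        card (D_set G k (k - 1) u v) + card (D_set G k k u v) + card (D_set G k (k + 1) u v)" for k
      unfolding su by (subst card_Un_disjoint card_Un_disjoint, use fin in \<open>auto simp: D\<close>)+
    have cv: "card {x \<in> pverts G. int (d v x) = k} =
        card (D_set G (k - 1) k u v) + card (D_set G k k u v) + card (D_set G (k + 1) k u v)" for k
      unfolding sv by (subst card_Un_disjoint card_Un_disjoint, use fin in \<open>auto simp: D\<close>)+
    have tel: "int (card {x \<in> pverts G. int (d u x) = k}) - int (card {x \<in> pverts G. int (d v x) = k})
        = E k - E (k + 1)" for k
      unfolding cu cv E_def by simp
    show ?thesis
    proof
      assume ?L
      then have "E k = 0" for k by (simp add: E_def)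
      then show ?R using tel[of "int _"] by simp
    next
      assume R: ?R
      have shift: "E (k + 1) = E k" for k
      proof (cases "k \<ge> 0")
        case True
        then obtain m where "k = int m" using nonneg_int_cases by blast
        then show ?thesis using tel[of "int m"] R by simp
      next
        case False
        \<comment> \<open>Distances are natural numbers, so at negative levels \<open>E\<close> is
          constant as well.\<close>
        then have empty: "{x \<in> pverts G. int (d w x) = k} = {}" for w by auto
        show ?thesis using tel[of k] unfolding empty by simp
      qed
      have "E (int m) = 0 \<and> E (- int m) = 0" for m
      proof (induction m)
        \<comment> \<open>\<open>E 0 = 0\<close>, because both of its sets ask for a vertex at
          distance -1.\<close>
        case 0
        show ?case unfolding E_def D by simp
      next
        case (Suc m)
        then show ?case using shift[of "int m"] shift[of "- int (Suc m)"] by (simp add: add.commute)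
      qed
      then have "E k = 0" for k by (cases k rule: int_cases2) auto
      then show ?L by (simp add: E_def)
    qed
  qed
  then show ?thesis unfolding strongly_distance_balanced_def by fast
qed

section \<open>Distances in generalized Petersen graphs\<close>

text \<open>
  The two rims have step sizes \<open>p\<close> and \<open>q\<close> and the walk starts on the rim with step \<open>p\<close>; it ends on
  the same rim or on the other one. The constants \<open>2\<close> and \<open>1\<close> count spokes.
\<close>

definition same_rim_dist :: "int \<Rightarrow> int \<Rightarrow> int \<Rightarrow> int \<Rightarrow> nat" where
  "same_rim_dist n p q x =
     (LEAST d. \<exists>a b. [a * p + b * q = x] (mod n) \<and> int d = \<bar>a\<bar> + \<bar>b\<bar> + (if b = 0 then 0 else 2))"

definition cross_rim_dist :: "int \<Rightarrow> int \<Rightarrow> int \<Rightarrow> int \<Rightarrow> nat" where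
  "cross_rim_dist n p q x =
     (LEAST d. \<exists>a b. [a * p + b * q = x] (mod n) \<and> int d = \<bar>a\<bar> + \<bar>b\<bar> + 1)"

section \<open>Attainment and one-step changes of the two rim distances\<close>

lemma same_rim_dist_le:
  assumes "[a * p + b * q = x] (mod n)"
  shows "int (same_rim_dist n p q x) \<le> \<bar>a\<bar> + \<bar>b\<bar> + (if b = 0 then 0 else 2)"
proof -
  have "same_rim_dist n p q x \<le> nat (\<bar>a\<bar> + \<bar>b\<bar> + (if b = 0 then 0 else 2))"
    unfolding same_rim_dist_def using assms by (intro Least_le exI[of _ a] exI[of _ b]) auto
  then show ?thesis by (simp split: if_splits)
qed

text \<open>A step size 1 lets every residue be represented, so the \<open>LEAST\<close> is taken
  over a nonempty set.\<close>

lemma same_rim_dist_attained: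
  assumes "p = 1 \<or> q = 1"
  obtains a b where "[a * p + b * q = x] (mod n)"
    and "int (same_rim_dist n p q x) = \<bar>a\<bar> + \<bar>b\<bar> + (if b = 0 then 0 else 2)"
proof -
  obtain a b where ab: "[a * p + b * q = x] (mod n)"
    using assms by (metis add_0 add.right_neutral cong_refl mult.right_neutral mult_zero_left)
  have "\<exists>d a b. [a * p + b * q = x] (mod n) \<and> int d = \<bar>a\<bar> + \<bar>b\<bar> + (if b = 0 then 0 else 2)"
    using ab by (intro exI[of _ "nat (\<bar>a\<bar> + \<bar>b\<bar> + (if b = 0 then 0 else 2))"] exI[of _ a] exI[of _ b]) auto
  from LeastI_ex[OF this] show ?thesis using that unfolding same_rim_dist_def by blast
qed

lemma cross_rim_dist_le:
  assumes "[a * p + b * q = x] (mod n)"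
  shows "int (cross_rim_dist n p q x) \<le> \<bar>a\<bar> + \<bar>b\<bar> + 1"
proof -
  have "cross_rim_dist n p q x \<le> nat (\<bar>a\<bar> + \<bar>b\<bar> + 1)"
    unfolding cross_rim_dist_def using assms by (intro Least_le exI[of _ a] exI[of _ b]) auto
  then show ?thesis by simp
qed

lemma cross_rim_dist_attained:
  assumes "p = 1 \<or> q = 1"
  obtains a b where "[a * p + b * q = x] (mod n)"
    and "int (cross_rim_dist n p q x) = \<bar>a\<bar> + \<bar>b\<bar> + 1"
proof -
  obtain a b where ab: "[a * p + b * q = x] (mod n)"
    using assms by (metis add_0 add.right_neutral cong_refl mult.right_neutral mult_zero_left)
  have "\<exists>d a b. [a * p + b * q = x] (mod n) \<and> int d = \<bar>a\<bar> + \<bar>b\<bar> + 1"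
    using ab by (intro exI[of _ "nat (\<bar>a\<bar> + \<bar>b\<bar> + 1)"] exI[of _ a] exI[of _ b]) auto
  from LeastI_ex[OF this] show ?thesis using that unfolding cross_rim_dist_def by blast
qed

lemma rim_dist_cong:
  assumes "[x = y] (mod n)"
  shows "same_rim_dist n p q x = same_rim_dist n p q y"
    and "cross_rim_dist n p q x = cross_rim_dist n p q y"
proof -
  have "[z = x] (mod n) \<longleftrightarrow> [z = y] (mod n)" for z using assms cong_trans cong_sym by blast
  then show "same_rim_dist n p q x = same_rim_dist n p q y"
    and "cross_rim_dist n p q x = cross_rim_dist n p q y"
    unfolding same_rim_dist_def cross_rim_dist_def by simp_all
qed

lemma same_rim_dist_0 [simp]: "same_rim_dist n p q 0 = 0"
  using same_rim_dist_le[of 0 p 0 q 0 n] by simp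

text \<open>The cost is symmetric in \<open>a\<close> and \<open>b\<close>. Hence cross distances
  seen from \<open>U i\<close> and from \<open>V i\<close> agree and cancel when spheres are
  compared.\<close>

lemma cross_rim_dist_swap: "cross_rim_dist n q p x = cross_rim_dist n p q x"
proof -
  have "(\<exists>a b. [a * q + b * p = x] (mod n) \<and> int d = \<bar>a\<bar> + \<bar>b\<bar> + 1) \<longleftrightarrow>
        (\<exists>a b. [a * p + b * q = x] (mod n) \<and> int d = \<bar>a\<bar> + \<bar>b\<bar> + 1)" for d
    by (subst ex_comm, intro ex_cong1) (simp add: add.commute add.left_commute)
  then show ?thesis unfolding cross_rim_dist_def by simp
qed

lemma same_rim_dist_step:
  assumes "p = 1 \<or> q = 1" "[y = x + p] (mod n) \<or> [x = y + p] (mod n)"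
  shows "same_rim_dist n p q y \<le> Suc (same_rim_dist n p q x)"
proof -
  obtain a b where ab: "[a * p + b * q = x] (mod n)"
    "int (same_rim_dist n p q x) = \<bar>a\<bar> + \<bar>b\<bar> + (if b = 0 then 0 else 2)"
    using same_rim_dist_attained assms(1) by blast
  have "[(a + 1) * p + b * q = y] (mod n) \<or> [(a - 1) * p + b * q = y] (mod n)"
    using assms(2)
  proof
    assume "[y = x + p] (mod n)"
    then have "[a * p + b * q + p = y] (mod n)"
      using ab(1) cong_add_rcancel cong_sym cong_trans by blast
    then show ?thesis by (simp add: algebra_simps)
  next
    assume "[x = y + p] (mod n)"
    then have "[a * p + b * q - p = y] (mod n)"
      using ab(1) cong_trans cong_diff[of "a * p + b * q" "y + p" n p p] by fastforce
    then show ?thesis by (simp add: algebra_simps)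
  qed
  then show ?thesis using same_rim_dist_le[of "a + 1" p b q y n] same_rim_dist_le[of "a - 1" p b q y n] ab(2)
    by (auto split: if_splits)
qed

text \<open>A walk counted here ends on the rim with step \<open>q\<close>, so the edge prolonging
  it has step \<open>q\<close>.\<close>

lemma cross_rim_dist_step:
  assumes "p = 1 \<or> q = 1" "[y = x + q] (mod n) \<or> [x = y + q] (mod n)"
  shows "cross_rim_dist n p q y \<le> Suc (cross_rim_dist n p q x)"
proof -
  obtain a b where ab: "[a * p + b * q = x] (mod n)"
    "int (cross_rim_dist n p q x) = \<bar>a\<bar> + \<bar>b\<bar> + 1"
    using cross_rim_dist_attained assms(1) by blast
  have "[a * p + (b + 1) * q = y] (mod n) \<or> [a * p + (b - 1) * q = y] (mod n)"
    using assms(2)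
  proof
    assume "[y = x + q] (mod n)"
    then have "[a * p + b * q + q = y] (mod n)"
      using ab(1) cong_add_rcancel cong_sym cong_trans by blast
    then show ?thesis by (simp add: algebra_simps)
  next
    assume "[x = y + q] (mod n)"
    then have "[a * p + b * q - q = y] (mod n)"
      using ab(1) cong_trans cong_diff[of "a * p + b * q" "y + q" n q q] by fastforce
    then show ?thesis by (simp add: algebra_simps)
  qed
  then show ?thesis using cross_rim_dist_le[of a p "b + 1" q y n] cross_rim_dist_le[of a p "b - 1" q y n] ab(2)
    by auto
qed

text \<open>One pair \<open>(a, b)\<close> serves both distances: for \<open>b = 0\<close> crossing
  adds a spoke, otherwise it saves one of the two.\<close>

lemma rim_dist_spoke:
  assumes "p = 1 \<or> q = 1"
  shows "cross_rim_dist n p q x \<le> Suc (same_rim_dist n p q x)"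
    and "same_rim_dist n p q x \<le> Suc (cross_rim_dist n p q x)"
proof -
  obtain a b where "[a * p + b * q = x] (mod n)"
    "int (same_rim_dist n p q x) = \<bar>a\<bar> + \<bar>b\<bar> + (if b = 0 then 0 else 2)"
    using same_rim_dist_attained assms by blast
  then show "cross_rim_dist n p q x \<le> Suc (same_rim_dist n p q x)"
    using cross_rim_dist_le[of a p b q x n] by (auto split: if_splits)
  obtain a b where "[a * p + b * q = x] (mod n)"
    "int (cross_rim_dist n p q x) = \<bar>a\<bar> + \<bar>b\<bar> + 1"
    using cross_rim_dist_attained assms by blast
  then show "same_rim_dist n p q x \<le> Suc (cross_rim_dist n p q x)"
    using same_rim_dist_le[of a p b q x n] by (auto split: if_splits)
qed

lemma int_shrink:
  fixes a :: int
  assumes "a \<noteq> 0"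
  obtains s where "s = 1 \<or> s = - 1" "\<bar>a - s\<bar> = \<bar>a\<bar> - 1"
  using assms that[of 1] that[of "- 1"] by (cases "a > 0") auto

lemma same_rim_dist_descent:
  assumes pq: "p = 1 \<or> q = 1" and x: "\<not> [x = 0] (mod n)"
  shows "same_rim_dist n p q (x - p) + 1 \<le> same_rim_dist n p q x \<or>
         same_rim_dist n p q (x + p) + 1 \<le> same_rim_dist n p q x \<or>
         cross_rim_dist n p q x + 1 \<le> same_rim_dist n p q x"
proof -
  obtain a b where ab: "[a * p + b * q = x] (mod n)"
    "int (same_rim_dist n p q x) = \<bar>a\<bar> + \<bar>b\<bar> + (if b = 0 then 0 else 2)"
    using same_rim_dist_attained pq by blast
  show ?thesis
  proof (cases "a = 0")
    case True
    then have "b \<noteq> 0" using ab(1) x by (auto simp: cong_sym_eq)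
    then show ?thesis using cross_rim_dist_le[OF ab(1)] ab(2) by auto
  next
    case False
    then obtain s where s: "s = 1 \<or> s = - 1" "\<bar>a - s\<bar> = \<bar>a\<bar> - 1" by (rule int_shrink)
    have "[(a - s) * p + b * q = x - s * p] (mod n)"
      using cong_diff[OF ab(1) cong_refl[of "s * p"]] by (simp add: algebra_simps)
    from same_rim_dist_le[OF this] show ?thesis using s ab(2) by (auto split: if_splits)
  qed
qed

lemma cross_rim_dist_descent:
  assumes pq: "p = 1 \<or> q = 1"
  shows "cross_rim_dist n p q (x - q) + 1 \<le> cross_rim_dist n p q x \<or>
         cross_rim_dist n p q (x + q) + 1 \<le> cross_rim_dist n p q x \<or>
         same_rim_dist n p q x + 1 \<le> cross_rim_dist n p q x"
proof -
  obtain a b where ab: "[a * p + b * q = x] (mod n)"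
    "int (cross_rim_dist n p q x) = \<bar>a\<bar> + \<bar>b\<bar> + 1"
    using cross_rim_dist_attained pq by blast
  show ?thesis
  proof (cases "b = 0")
    case True
    then show ?thesis using same_rim_dist_le[OF ab(1)] ab(2) by auto
  next
    case False
    then obtain s where s: "s = 1 \<or> s = - 1" "\<bar>b - s\<bar> = \<bar>b\<bar> - 1" by (rule int_shrink)
    have "[a * p + (b - s) * q = x - s * q] (mod n)"
      using cong_diff[OF ab(1) cong_refl[of "s * q"]] by (simp add: algebra_simps)
    from cross_rim_dist_le[OF this] show ?thesis using s ab(2) by auto
  qed
qed

section \<open>The distance function of a generalized Petersen graph\<close>

lemma verts_GP: "pverts (GP n k) = U ` {..<n} \<union> V ` {..<n}"
  by (simp add: GP_def)

lemma succ_mod_iff: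
  fixes i j n k :: nat
  assumes "j < n"
  shows "j = (i + k) mod n \<longleftrightarrow> [int j = int i + int k] (mod int n)"
  using assms by (metis cong_def cong_int_iff mod_less of_nat_add)

lemma arcs_GP:
  assumes "n > 0"
  shows "(U i, U j) \<in> parcs (GP n k) \<longleftrightarrow>
      i < n \<and> j < n \<and> ([int j = int i + 1] (mod int n) \<or> [int i = int j + 1] (mod int n))"
    and "(V i, V j) \<in> parcs (GP n k) \<longleftrightarrow>
      i < n \<and> j < n \<and> ([int j = int i + int k] (mod int n) \<or> [int i = int j + int k] (mod int n))"
    and "(U i, V j) \<in> parcs (GP n k) \<longleftrightarrow> i < n \<and> i = j"
    and "(V i, U j) \<in> parcs (GP n k) \<longleftrightarrow> i < n \<and> i = j"
proof -
  have "(U i, U j) \<in> parcs (GP n k) \<longleftrightarrow>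
      i < n \<and> j < n \<and> (j = (i + 1) mod n \<or> i = (j + 1) mod n)"
    using assms by (auto simp: GP_def GP_edges_def)
  then show "(U i, U j) \<in> parcs (GP n k) \<longleftrightarrow>
      i < n \<and> j < n \<and> ([int j = int i + 1] (mod int n) \<or> [int i = int j + 1] (mod int n))"
    using succ_mod_iff[of j n i 1] succ_mod_iff[of i n j 1] by (metis of_nat_1)
  have "(V i, V j) \<in> parcs (GP n k) \<longleftrightarrow>
      i < n \<and> j < n \<and> (j = (i + k) mod n \<or> i = (j + k) mod n)"
    using assms by (auto simp: GP_def GP_edges_def)
  then show "(V i, V j) \<in> parcs (GP n k) \<longleftrightarrow>
      i < n \<and> j < n \<and> ([int j = int i + int k] (mod int n) \<or> [int i = int j + int k] (mod int n))"
    using succ_mod_iff[of j n i k] succ_mod_iff[of i n j k] by metis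
qed (auto simp: GP_def GP_edges_def)

fun GP_dist :: "nat \<Rightarrow> nat \<Rightarrow> gp_vertex \<Rightarrow> gp_vertex \<Rightarrow> nat" where
  "GP_dist n k (U i) (U j) = same_rim_dist (int n) 1 (int k) (int j - int i)"
| "GP_dist n k (U i) (V j) = cross_rim_dist (int n) 1 (int k) (int j - int i)"
| "GP_dist n k (V i) (V j) = same_rim_dist (int n) (int k) 1 (int j - int i)"
| "GP_dist n k (V i) (U j) = cross_rim_dist (int n) (int k) 1 (int j - int i)"

lemma cong_shift_diff:
  fixes i j l p n :: int
  assumes "[i = j + p] (mod n)"
  shows "[i - l = j - l + p] (mod n)" and "[l - j = l - i + p] (mod n)"
  using assms by (simp_all add: cong_iff_dvd_diff algebra_simps)

lemma GP_dist_step: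
  assumes "n > 0" "(x, y) \<in> parcs (GP n k)"
  shows "GP_dist n k u y \<le> GP_dist n k u x + 1"
  using assms
  by (cases u; cases x; cases y)
     (auto simp: arcs_GP intro!: same_rim_dist_step cross_rim_dist_step rim_dist_spoke dest: cong_shift_diff(1))

text \<open>Here the step belongs to the starting rim; exchanging the rims turns it into a step at
  the end.\<close>

lemma cross_rim_dist_step':
  assumes "[y = x + p] (mod n) \<or> [x = y + p] (mod n)" "p = 1 \<or> q = 1"
  shows "cross_rim_dist n p q y \<le> Suc (cross_rim_dist n p q x)"
  using cross_rim_dist_step[of q p y x n] assms by (auto simp: cross_rim_dist_swap[of n q p])

text \<open>Moving the source changes the index difference by one rim step, or, along a spoke,
  exchanges the two step sizes.\<close>

lemma GP_dist_step_source:
  assumes "n > 0" "(u, v) \<in> parcs (GP n k)"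
  shows "GP_dist n k u x \<le> GP_dist n k v x + 1"
proof (cases u; cases v; cases x)
  fix i j l
  show ?thesis if "u = U i" "v = U j" "x = U l"
    using assms that cong_shift_diff(2)[of _ _ _ _ "int l"]
    by (auto simp: arcs_GP intro!: same_rim_dist_step)
  show ?thesis if "u = U i" "v = U j" "x = V l"
    using assms that cong_shift_diff(2)[of _ _ _ _ "int l"]
    by (auto simp: arcs_GP intro!: cross_rim_dist_step')
  show ?thesis if "u = V i" "v = V j" "x = V l"
    using assms that cong_shift_diff(2)[of _ _ _ _ "int l"]
    by (auto simp: arcs_GP intro!: same_rim_dist_step)
  show ?thesis if "u = V i" "v = V j" "x = U l"
    using assms that cong_shift_diff(2)[of _ _ _ _ "int l"]
    by (auto simp: arcs_GP intro!: cross_rim_dist_step')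
  show ?thesis if "u = U i" "v = V j" "x = U l"
    using assms that rim_dist_spoke(2)[of 1 "int k"]
    by (simp add: arcs_GP cross_rim_dist_swap[of _ "int k" 1])
  show ?thesis if "u = U i" "v = V j" "x = V l"
    using assms that rim_dist_spoke(1)[of "int k" 1]
    by (simp add: arcs_GP cross_rim_dist_swap[of _ "int k" 1])
  show ?thesis if "u = V i" "v = U j" "x = U l"
    using assms that rim_dist_spoke(1)[of 1 "int k"]
    by (simp add: arcs_GP cross_rim_dist_swap[of _ "int k" 1])
  show ?thesis if "u = V i" "v = U j" "x = V l"
    using assms that rim_dist_spoke(2)[of "int k" 1]
    by (simp add: arcs_GP cross_rim_dist_swap[of _ "int k" 1])
qed

text \<open>The neighbours of \<open>y\<close> are its two rim neighbours, with indices
  \<open>l\<close> and \<open>m\<close>, and its spoke partner; these match the three alternatives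
  of the descent lemmas for rim distances.\<close>

lemma GP_dist_descent:
  assumes n: "n > 0" and u: "u \<in> pverts (GP n k)" and y: "y \<in> pverts (GP n k)" "y \<noteq> u"
  shows "\<exists>x. (x, y) \<in> parcs (GP n k) \<and> GP_dist n k u x + 1 \<le> GP_dist n k u y"
proof -
  have rep: "\<exists>j < n. [int j = z] (mod int n)" for z
    using n by (intro exI[of _ "nat (z mod int n)"]) (simp add: nat_less_iff cong_def)
  have nz: "\<not> [int j - int i = 0] (mod int n)" if "i < n" "j < n" "j \<noteq> i" for i j
    using that by (metis cong_diff_iff_cong_0 cong_int_iff cong_less_modulus_unique_nat)
  have prev: "\<exists>l < n. [int j = int l + p] (mod int n) \<and> [int l - i = int j - i - p] (mod int n)" for j i p
    using rep[of "int j - p"] by (elim exE conjE) (auto simp: cong_iff_dvd_diff algebra_simps dvd_diff_commute)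
  have succ: "\<exists>l < n. [int l = int j + p] (mod int n) \<and> [int l - i = int j - i + p] (mod int n)" for j i p
    using rep[of "int j + p"] by (elim exE conjE) (auto simp: cong_iff_dvd_diff algebra_simps)
  show ?thesis
  proof (cases u; cases y)
    fix i j assume uy: "u = U i" "y = U j"
    then have ij: "i < n" "j < n" "j \<noteq> i" using u y by (auto simp: verts_GP)
    obtain l where l: "l < n" "[int j = int l + 1] (mod int n)"
      "[int l - int i = int j - int i - 1] (mod int n)" using prev by blast
    obtain m where m: "m < n" "[int m = int j + 1] (mod int n)"
      "[int m - int i = int j - int i + 1] (mod int n)" using succ by blast
    have "(U l, y) \<in> parcs (GP n k)" "(U m, y) \<in> parcs (GP n k)" "(V j, y) \<in> parcs (GP n k)"
      using l m ij n uy by (auto simp: arcs_GP)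
    then show ?thesis
      using same_rim_dist_descent[of 1 "int k", OF _ nz[OF ij]] uy
        rim_dist_cong(1)[OF l(3)] rim_dist_cong(1)[OF m(3)]
      by (metis GP_dist.simps(1,2))
  next
    fix i j assume uy: "u = V i" "y = V j"
    then have ij: "i < n" "j < n" "j \<noteq> i" using u y by (auto simp: verts_GP)
    obtain l where l: "l < n" "[int j = int l + int k] (mod int n)"
      "[int l - int i = int j - int i - int k] (mod int n)" using prev by blast
    obtain m where m: "m < n" "[int m = int j + int k] (mod int n)"
      "[int m - int i = int j - int i + int k] (mod int n)" using succ by blast
    have "(V l, y) \<in> parcs (GP n k)" "(V m, y) \<in> parcs (GP n k)" "(U j, y) \<in> parcs (GP n k)"
      using l m ij n uy by (auto simp: arcs_GP)
    then show ?thesis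
      using same_rim_dist_descent[of "int k" 1, OF _ nz[OF ij]] uy
        rim_dist_cong(1)[OF l(3)] rim_dist_cong(1)[OF m(3)]
      by (metis GP_dist.simps(3,4))
  next
    fix i j assume uy: "u = U i" "y = V j"
    then have ij: "i < n" "j < n" using u y by (auto simp: verts_GP)
    obtain l where l: "l < n" "[int j = int l + int k] (mod int n)"
      "[int l - int i = int j - int i - int k] (mod int n)" using prev by blast
    obtain m where m: "m < n" "[int m = int j + int k] (mod int n)"
      "[int m - int i = int j - int i + int k] (mod int n)" using succ by blast
    have "(V l, y) \<in> parcs (GP n k)" "(V m, y) \<in> parcs (GP n k)" "(U j, y) \<in> parcs (GP n k)"
      using l m ij n uy by (auto simp: arcs_GP)
    then show ?thesis
      using cross_rim_dist_descent[of 1 "int k" "int n" "int j - int i"] uy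
        rim_dist_cong(2)[OF l(3)] rim_dist_cong(2)[OF m(3)]
      by (metis GP_dist.simps(1,2))
  next
    fix i j assume uy: "u = V i" "y = U j"
    then have ij: "i < n" "j < n" using u y by (auto simp: verts_GP)
    obtain l where l: "l < n" "[int j = int l + 1] (mod int n)"
      "[int l - int i = int j - int i - 1] (mod int n)" using prev by blast
    obtain m where m: "m < n" "[int m = int j + 1] (mod int n)"
      "[int m - int i = int j - int i + 1] (mod int n)" using succ by blast
    have "(U l, y) \<in> parcs (GP n k)" "(U m, y) \<in> parcs (GP n k)" "(V j, y) \<in> parcs (GP n k)"
      using l m ij n uy by (auto simp: arcs_GP)
    then show ?thesis
      using cross_rim_dist_descent[of "int k" 1 "int n" "int j - int i"] uy
        rim_dist_cong(2)[OF l(3)] rim_dist_cong(2)[OF m(3)]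
      by (metis GP_dist.simps(3,4))
  qed
qed

lemma graph_dist_GP:
  assumes "2 \<le> n" "0 < k" "k < n" and u: "u \<in> pverts (GP n k)" and v: "v \<in> pverts (GP n k)"
  shows "graph_dist (GP n k) u v = ereal (real (GP_dist n k u v))"
proof (rule graph_dist_eqI[OF _ u v])
  interpret pair_graph "GP n k" using pair_graph_GP assms by blast
  show "wf_digraph (with_proj (GP n k))" by unfold_locales
  show "GP_dist n k u u = 0" by (cases u) simp_all
qed (use assms GP_dist_step GP_dist_descent in auto)

section \<open>Sphere sizes and the reduction to a comparison of the rims\<close>

definition rim_sphere :: "int \<Rightarrow> int \<Rightarrow> int \<Rightarrow> nat \<Rightarrow> nat" where
  "rim_sphere n p q m = card {z \<in> {0..<n}. same_rim_dist n p q z = m}"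

lemma card_translate_mod:
  fixes i n :: nat and P :: "int \<Rightarrow> bool"
  assumes "i < n" and P: "\<And>x y. [x = y] (mod int n) \<Longrightarrow> P x = P y"
  shows "card {j \<in> {..<n}. P (int j - int i)} = card {z \<in> {0..<int n}. P z}"
proof (rule bij_betw_same_card[of "\<lambda>j. (int j - int i) mod int n"],
       rule bij_betw_byWitness[of _ "\<lambda>z. nat ((z + int i) mod int n)"])
  show "\<forall>a\<in>{j \<in> {..<n}. P (int j - int i)}. nat (((int a - int i) mod int n + int i) mod int n) = a"
    by (auto simp: mod_add_left_eq)
  show "\<forall>a'\<in>{z \<in> {0..<int n}. P z}. (int (nat ((a' + int i) mod int n)) - int i) mod int n = a'"
    using assms(1) by (auto simp: mod_diff_left_eq)
  have "P (z mod int n) = P z" for z by (rule P) simp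
  then show "(\<lambda>j. (int j - int i) mod int n) ` {j \<in> {..<n}. P (int j - int i)} \<subseteq> {z \<in> {0..<int n}. P z}"
    using assms(1) by auto
  have shift: "P ((z + int i) mod int n - int i)" if "P z" for z
    using that P[of "(z + int i) mod int n - int i" z] by (simp add: cong_def mod_diff_left_eq)
  show "(\<lambda>z. nat ((z + int i) mod int n)) ` {z \<in> {0..<int n}. P z} \<subseteq> {j \<in> {..<n}. P (int j - int i)}"
    using assms(1) by (auto simp: nat_less_iff intro: shift)
qed

text \<open>The sphere is split by rims and translated so that its centre gets index 0. The part on
  the opposite rim has the same size for both kinds of centre.\<close>

lemma card_sphere_GP:
  assumes "i < n"
  shows "card {x \<in> pverts (GP n k). GP_dist n k (U i) x = m} =
           rim_sphere (int n) 1 (int k) m + card {z \<in> {0..<int n}. cross_rim_dist (int n) 1 (int k) z = m}"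
    and "card {x \<in> pverts (GP n k). GP_dist n k (V i) x = m} =
           rim_sphere (int n) (int k) 1 m + card {z \<in> {0..<int n}. cross_rim_dist (int n) 1 (int k) z = m}"
proof -
  have split: "card {x \<in> pverts (GP n k). P x} = card {j \<in> {..<n}. P (U j)} + card {j \<in> {..<n}. P (V j)}" for P
  proof -
    have "{x \<in> pverts (GP n k). P x} = U ` {j \<in> {..<n}. P (U j)} \<union> V ` {j \<in> {..<n}. P (V j)}"
      by (auto simp: verts_GP)
    moreover have "card \<dots> = card (U ` {j \<in> {..<n}. P (U j)}) + card (V ` {j \<in> {..<n}. P (V j)})"
      by (intro card_Un_disjoint) auto
    ultimately show ?thesis by (simp add: card_image inj_on_def)
  qed
  have same: "card {j \<in> {..<n}. same_rim_dist (int n) p q (int j - int i) = m} = rim_sphere (int n) p q m" for p q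
    unfolding rim_sphere_def
    by (rule card_translate_mod[OF assms, of "\<lambda>z. same_rim_dist (int n) p q z = m"])
       (metis rim_dist_cong(1))
  have cross: "card {j \<in> {..<n}. cross_rim_dist (int n) p q (int j - int i) = m} =
      card {z \<in> {0..<int n}. cross_rim_dist (int n) p q z = m}" for p q
    by (rule card_translate_mod[OF assms, of "\<lambda>z. cross_rim_dist (int n) p q z = m"])
       (metis rim_dist_cong(2))
  show "card {x \<in> pverts (GP n k). GP_dist n k (U i) x = m} =
           rim_sphere (int n) 1 (int k) m + card {z \<in> {0..<int n}. cross_rim_dist (int n) 1 (int k) z = m}"
    unfolding split GP_dist.simps same cross ..
  show "card {x \<in> pverts (GP n k). GP_dist n k (V i) x = m} =
           rim_sphere (int n) (int k) 1 m + card {z \<in> {0..<int n}. cross_rim_dist (int n) 1 (int k) z = m}"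
    unfolding split GP_dist.simps same cross cross_rim_dist_swap[of _ "int k" 1] by (rule add.commute)
qed

text \<open>Sphere sizes do not depend on the index of the centre, so rim edges impose no condition,
  and all spokes impose the same one.\<close>

theorem strongly_distance_balanced_GP_iff:
  assumes nk: "2 \<le> n" "0 < k" "k < n"
  shows "strongly_distance_balanced (GP n k) \<longleftrightarrow>
    (\<forall>m. rim_sphere (int n) 1 (int k) m = rim_sphere (int n) (int k) 1 m)"
proof -
  interpret pair_graph "GP n k" using pair_graph_GP nk by blast
  have "strongly_distance_balanced (GP n k) \<longleftrightarrow> (\<forall>(u, v) \<in> parcs (GP n k). \<forall>j.
      card {x \<in> pverts (GP n k). GP_dist n k u x = j} = card {x \<in> pverts (GP n k). GP_dist n k v x = j})"
  proof (rule strongly_distance_balanced_iff_spheres)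
    show "finite (pverts (GP n k))" by (simp add: verts_GP)
    show "u \<in> pverts (GP n k) \<and> v \<in> pverts (GP n k)" if "(u, v) \<in> parcs (GP n k)" for u v
      using that wellformed by fastforce
    show "graph_dist (GP n k) u x = ereal (real (GP_dist n k u x))"
      if "u \<in> pverts (GP n k)" "x \<in> pverts (GP n k)" for u x
      using graph_dist_GP nk that by blast
    show "GP_dist n k u x \<le> GP_dist n k v x + 1 \<and> GP_dist n k v x \<le> GP_dist n k u x + 1"
      if "(u, v) \<in> parcs (GP n k)" for u v x
    proof -
      have "(v, u) \<in> parcs (GP n k)" using that by (auto simp: GP_def)
      then show ?thesis using that nk GP_dist_step_source by auto
    qed
  qed
  also have "\<dots> \<longleftrightarrow> (\<forall>m. rim_sphere (int n) 1 (int k) m = rim_sphere (int n) (int k) 1 m)" (is "?L \<longleftrightarrow> ?R")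
  proof
    assume L: ?L
    have "(U 0, V 0) \<in> parcs (GP n k)" using nk by (simp add: arcs_GP)
    with L show ?R using nk by (auto simp: card_sphere_GP)
  next
    assume R: ?R
    have "card {x \<in> pverts (GP n k). GP_dist n k u x = j} = card {x \<in> pverts (GP n k). GP_dist n k v x = j}"
      if "(u, v) \<in> parcs (GP n k)" for u v j
    proof -
      have "u \<in> pverts (GP n k)" "v \<in> pverts (GP n k)" using that wellformed by fastforce+
      then have "\<exists>i < n. u = U i \<or> u = V i" "\<exists>i < n. v = U i \<or> v = V i" by (auto simp: verts_GP)
      then show ?thesis using R by (elim exE conjE disjE) (simp_all add: card_sphere_GP)
    qed
    then show ?L by blast
  qed
  finally show ?thesis .
qed

section \<open>Comparing the two rims\<close>

text \<open>Multiplication by \<open>l\<close> sends steps \<open>p\<close> and \<open>q\<close> to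
  steps \<open>p'\<close> and \<open>q'\<close> up to the signs \<open>e\<close> and
  \<open>e'\<close>, so it carries a walk to a walk of the same cost.\<close>

lemma same_rim_dist_scale_le:
  assumes pq: "p = 1 \<or> q = 1" and p: "[l * p = e * p'] (mod n)" and q: "[l * q = e' * q'] (mod n)"
    and e: "\<bar>e\<bar> = 1" "\<bar>e'\<bar> = 1"
  shows "same_rim_dist n p' q' (l * x) \<le> same_rim_dist n p q x"
proof -
  obtain a b where ab: "[a * p + b * q = x] (mod n)"
    "int (same_rim_dist n p q x) = \<bar>a\<bar> + \<bar>b\<bar> + (if b = 0 then 0 else 2)"
    using same_rim_dist_attained pq by blast
  have "[(a * e) * p' + (b * e') * q' = a * (l * p) + b * (l * q)] (mod n)"
    using cong_add[OF cong_scalar_left[OF p, of a] cong_scalar_left[OF q, of b]]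
    by (simp add: cong_sym_eq mult.assoc)
  also have "a * (l * p) + b * (l * q) = l * (a * p + b * q)" by (simp add: algebra_simps)
  also have "[l * (a * p + b * q) = l * x] (mod n)" using ab(1) by (rule cong_scalar_left)
  finally have "int (same_rim_dist n p' q' (l * x)) \<le> \<bar>a * e\<bar> + \<bar>b * e'\<bar> + (if b * e' = 0 then 0 else 2)"
    by (rule same_rim_dist_le)
  then show ?thesis using ab(2) e by (auto simp: abs_mult split: if_splits)
qed

lemma same_rim_dist_uminus:
  assumes "p = 1 \<or> q = 1"
  shows "same_rim_dist n p q (- x) = same_rim_dist n p q x"
proof -
  have le: "same_rim_dist n p q (- y) \<le> same_rim_dist n p q y" for y
    using same_rim_dist_scale_le[OF assms, of "- 1" "- 1" p n "- 1" q y] by simp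
  show ?thesis using le[of x] le[of "- x"] by simp
qed

lemma bij_betw_mult_mod:
  fixes l l' n :: int
  assumes "n > 0" "[l * l' = 1] (mod n)"
  shows "bij_betw (\<lambda>x. l * x mod n) {0..<n} {0..<n}"
proof (rule bij_betw_byWitness[of _ "\<lambda>x. l' * x mod n"])
  have inverse: "h * (h' * x mod n) mod n = x" if "[h * h' = 1] (mod n)" "x \<in> {0..<n}" for h h' x
  proof -
    have "h * (h' * x mod n) mod n = (h * h') * x mod n" by (simp add: mod_mult_right_eq mult.assoc)
    also have "\<dots> = 1 * x mod n" using cong_scalar_right[OF that(1), of x] by (simp add: cong_def)
    finally show ?thesis using that(2) by simp
  qed
  show "\<forall>a\<in>{0..<n}. l' * (l * a mod n) mod n = a"
    using inverse[of l' l] assms(2) by (simp add: mult.commute)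
  show "\<forall>a'\<in>{0..<n}. l * (l' * a' mod n) mod n = a'" using inverse[of l l'] assms(2) by simp
qed (use assms in auto)

lemma rim_sphere_eqI:
  assumes "bij_betw f {0..<n} {0..<n}"
    and "\<And>x. x \<in> {0..<n} \<Longrightarrow> same_rim_dist n p' q' (f x) = same_rim_dist n p q x"
  shows "rim_sphere n p q m = rim_sphere n p' q' m"
proof -
  have "f ` {z \<in> {0..<n}. same_rim_dist n p q z = m} = {z \<in> f ` {0..<n}. same_rim_dist n p' q' z = m}"
    using assms(2) by auto
  then have "bij_betw f {z \<in> {0..<n}. same_rim_dist n p q z = m} {z \<in> {0..<n}. same_rim_dist n p' q' z = m}"
    unfolding bij_betw_imp_surj_on[OF assms(1)] by (rule bij_betw_subset[OF assms(1), rotated]) blast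
  then show ?thesis unfolding rim_sphere_def by (rule bij_betw_same_card)
qed

text \<open>Equal sphere sizes would mean equal multisets of distances and hence equal sums, which a
  pointwise inequality with one strict instance forbids.\<close>

lemma rim_spheres_neqI:
  assumes bij: "bij_betw f {0..<n} {0..<n}"
    and le: "\<And>x. x \<in> {0..<n} \<Longrightarrow> same_rim_dist n p' q' (f x) \<le> same_rim_dist n p q x"
    and less: "x \<in> {0..<n}" "same_rim_dist n p' q' (f x) < same_rim_dist n p q x"
  shows "\<exists>m. rim_sphere n p q m \<noteq> rim_sphere n p' q' m"
proof (rule ccontr)
  assume "\<not> ?thesis"
  then have "image_mset (same_rim_dist n p q) (mset_set {0..<n}) = image_mset (same_rim_dist n p' q') (mset_set {0..<n})"
    by (intro multiset_eqI) (simp add: count_image_mset_eq_card_vimage rim_sphere_def)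
  then have "(\<Sum>x\<in>{0..<n}. same_rim_dist n p q x) = (\<Sum>x\<in>{0..<n}. same_rim_dist n p' q' x)"
    by (simp add: sum_unfold_sum_mset)
  also have "\<dots> = (\<Sum>x\<in>{0..<n}. same_rim_dist n p' q' (f x))"
    using sum.reindex_bij_betw[OF bij, of "same_rim_dist n p' q'"] by simp
  also have "\<dots> < (\<Sum>x\<in>{0..<n}. same_rim_dist n p q x)"
    by (rule sum_strict_mono_ex1) (use le less in auto)
  finally show False by simp
qed

text \<open>Multiplication by \<open>l\<close> turns step 1 into \<open>l\<close> and step
  \<open>k\<close> into 1 up to sign, so it exchanges the rims; its inverse is multiplication by
  \<open>e * k\<close>. For \<open>l = k\<close> this compares the two rims of one graph.\<close>

lemma rim_sphere_swap:
  assumes n: "n > 0" and kl: "[k * l = e] (mod n)" and e: "\<bar>e\<bar> = 1"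
  shows "rim_sphere n 1 k m = rim_sphere n l 1 m"
proof -
  have ee: "e * e = 1" using e by (auto simp: abs_if split: if_splits)
  have inv: "[l * (e * k) = 1] (mod n)"
    using cong_scalar_left[OF kl, of e] ee by (simp add: ac_simps)
  show ?thesis
  proof (rule rim_sphere_eqI[OF bij_betw_mult_mod[OF n inv]])
    fix x
    have "same_rim_dist n l 1 (l * x) \<le> same_rim_dist n 1 k x"
      using same_rim_dist_scale_le[of 1 k l 1 l n e 1 x] kl e by (simp add: mult.commute)
    moreover have "same_rim_dist n 1 k (e * k * (l * x)) \<le> same_rim_dist n l 1 (l * x)"
      using same_rim_dist_scale_le[of l 1 "e * k" 1 1 n e k "l * x"] inv e by (simp add: ac_simps)
    moreover have "[e * k * (l * x) = x] (mod n)"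
      using cong_scalar_right[OF inv, of x] by (simp add: ac_simps)
    ultimately have "same_rim_dist n l 1 (l * x) = same_rim_dist n 1 k x"
      using rim_dist_cong(1) by (metis le_antisym)
    then show "same_rim_dist n l 1 (l * x mod n) = same_rim_dist n 1 k x"
      using rim_dist_cong(1)[of "l * x mod n" "l * x" n l 1] by simp
  qed
qed

section \<open>The case where 3 divides k\<close>

text \<open>Any other member of the residue class differs from \<open>r\<close> by at least
  \<open>q\<close>.\<close>

lemma abs_le_of_cong_least:
  fixes r y q :: int
  assumes "[y = r] (mod q)" "2 * \<bar>r\<bar> \<le> q"
  shows "y = r \<or> q - \<bar>r\<bar> \<le> \<bar>y\<bar>"
proof -
  obtain t where t: "y = r + q * t"
    using assms(1) by (metis cong_iff_lin cong_sym)
  have "\<bar>q * t\<bar> \<ge> q" if "t \<noteq> 0"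
    using that assms(2) mult_left_mono[of 1 "\<bar>t\<bar>" q] by (simp add: abs_mult)
  then show ?thesis using t by (cases "t = 0") auto
qed

text \<open>The modulus is \<open>3 * q\<close>: the sign \<open>e = - 1\<close> gives
  \<open>n = 3 k + 3\<close>, and \<open>e = 1\<close> gives \<open>n = 3 k - 3\<close>. The bound
  on \<open>q\<close> excludes \<open>k = 3\<close> in the second family, where \<open>q\<close>
  would be 2.\<close>

locale three_fold_GP =
  fixes q e k :: int
  assumes q: "q \<ge> 4" and e: "e = 1 \<or> e = - 1" and k: "k = q + e" and three: "3 dvd k"
begin

text \<open>
  \<open>res x\<close> is the absolutely least residue of \<open>x\<close> modulo \<open>q\<close>. If \<open>e a + b = res x\<close>, then \<open>reflect\<close>
  takes \<open>x = a k + b\<close> to \<open>e a + e b k\<close>, thus exchanging the rims at no cost.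
\<close>

definition res :: "int \<Rightarrow> int" where
  "res x = (x + (q - 1) div 2) mod q - (q - 1) div 2"

definition reflect :: "int \<Rightarrow> int" where
  "reflect x = (res x + e * q * x) mod (3 * q)"

lemma ee: "e * e = 1" "e * (e * x) = x"
  using e by auto

lemma res_cong: "[res x = x] (mod q)"
  unfolding res_def by (simp add: cong_def mod_diff_left_eq)

text \<open>The values of \<open>res\<close> range from \<open>- ((q - 1) div 2)\<close> to
  \<open>q div 2\<close>.\<close>

lemma res_least: "2 * \<bar>res x\<bar> \<le> q"
proof -
  have "0 \<le> (x + (q - 1) div 2) mod q" "(x + (q - 1) div 2) mod q < q" using q by simp_all
  moreover have "2 * ((q - 1) div 2) \<le> q - 1" "q - 2 \<le> 2 * ((q - 1) div 2)" by simp_all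
  ultimately show ?thesis unfolding res_def by (simp add: abs_if)
qed

lemma res_eq: "[x = y] (mod q) \<Longrightarrow> res x = res y"
  unfolding res_def by (metis cong_add_rcancel cong_def)

lemma reflect_cong: "[reflect x = res x + e * q * x] (mod (3 * q))"
  unfolding reflect_def by simp

lemma res_reflect: "res (reflect x) = res x"
proof -
  have "[reflect x = res x + e * q * x] (mod q)"
    using reflect_cong cong_dvd_modulus[of "reflect x" _ "3 * q" q] by simp
  also have "[res x + e * q * x = res x] (mod q)" by (simp add: cong_iff_dvd_diff)
  also note res_cong
  finally have "[reflect x = x] (mod q)" .
  then show ?thesis by (rule res_eq)
qed

lemma cong_3q: "[u = v] (mod 3) \<Longrightarrow> [q * u = q * v] (mod (3 * q))"
  using cong_iff_dvd_diff by (metis mult.commute mult_dvd_mono dvd_refl right_diff_distrib)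

text \<open>For \<open>x = res x + q * t\<close>, the second application restores \<open>t\<close>
  modulo 3, because \<open>3 dvd k\<close> means that \<open>q\<close> is \<open>- e\<close> modulo
  3.\<close>

lemma reflect_reflect:
  assumes "x \<in> {0..<3 * q}"
  shows "reflect (reflect x) = x"
proof -
  obtain t where t: "x = res x + q * t"
    using res_cong[of x] by (metis cong_iff_lin)
  obtain w where w: "q = 3 * w - e" using three k by (metis dvd_def add_diff_cancel_right')
  have "[e * (res x + e * q * x) = t] (mod 3)"
  proof -
    have "e * (res x + e * q * x) - t = e * res x + q * x - t" by (simp add: distrib_left mult.assoc ee)
    also have "\<dots> = e * res x + q * (res x + q * t) - t" by (simp flip: t)
    also have "\<dots> = 3 * (w * res x + (3 * w * w - 2 * w * e) * t)"
      unfolding w by (simp add: algebra_simps ee)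
    finally show ?thesis unfolding cong_iff_dvd_diff by simp
  qed
  then have "[q * (e * (res x + e * q * x)) = q * t] (mod (3 * q))" by (rule cong_3q)
  moreover have "[e * q * reflect x = e * q * (res x + e * q * x)] (mod (3 * q))"
    using reflect_cong by (rule cong_scalar_left)
  ultimately have "[e * q * reflect x = q * t] (mod (3 * q))"
    by (metis cong_trans mult.assoc mult.commute)
  then have "[res x + e * q * reflect x = x] (mod (3 * q))"
    using t cong_add_lcancel by metis
  then have "[reflect (reflect x) = x] (mod (3 * q))"
    using reflect_cong[of "reflect x"] unfolding res_reflect by (rule cong_trans[rotated])
  then show ?thesis using assms q unfolding reflect_def[of "reflect x"] by (simp add: cong_def)
qed

lemma bij_reflect: "bij_betw reflect {0..<3 * q} {0..<3 * q}"
  by (rule bij_betw_byWitness[of _ reflect]) (use reflect_reflect q in \<open>auto simp: reflect_def\<close>)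

lemma rim_rep_cong_q:
  assumes "[a * k + b = x] (mod (3 * q))"
  shows "[e * a + b = res x] (mod q)"
proof -
  have "[a * k + b = x] (mod q)" using assms cong_dvd_modulus[of _ _ "3 * q" q] by simp
  moreover have "[e * a + b = a * k + b] (mod q)" unfolding k cong_iff_dvd_diff by (simp add: algebra_simps)
  ultimately show ?thesis using res_cong[of x] by (metis cong_trans cong_sym)
qed

text \<open>As 3 divides \<open>k\<close>, \<open>x\<close> is congruent to \<open>b\<close> modulo
  3, and the summand \<open>e * q * x\<close> depends only on that residue.\<close>

lemma reflect_rep:
  assumes "[a * k + b = x] (mod (3 * q))"
  shows "[reflect x = res x + e * q * b] (mod (3 * q))"
proof -
  have "[x = a * k + b] (mod 3)"
    using cong_dvd_modulus[OF assms, of 3] by (simp add: cong_sym_eq)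
  also have "[a * k + b = b] (mod 3)" using three by (simp add: cong_iff_dvd_diff)
  finally have "[q * (e * x) = q * (e * b)] (mod (3 * q))"
    by (intro cong_3q cong_scalar_left)
  then have "[res x + e * q * x = res x + e * q * b] (mod (3 * q))"
    by (simp add: cong_add_lcancel ac_simps)
  then show ?thesis using reflect_cong cong_trans by blast
qed

text \<open>For \<open>x = r + q * t\<close>, any \<open>c\<close> congruent to \<open>t\<close>
  modulo 3 gives the representation \<open>(r - e * c) + c * k\<close>; it remains to choose
  \<open>c\<close> cheaply. The bound serves inner walks that go around past the least
  residue.\<close>

lemma outer_dist_le:
  assumes r: "2 * \<bar>r\<bar> \<le> q" and x: "[x = r] (mod q)"
  shows "int (same_rim_dist (3 * q) 1 k x) \<le> q - \<bar>r\<bar> + 2"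
proof -
  obtain t where t: "x = r + q * t" using x by (metis cong_iff_lin cong_sym)
  have bound: "int (same_rim_dist (3 * q) 1 k x) \<le> \<bar>r - e * c\<bar> + \<bar>c\<bar> + (if c = 0 then 0 else 2)"
    if "[c = t] (mod 3)" for c
  proof (rule same_rim_dist_le)
    have "(r - e * c) * 1 + c * k = r + q * c" unfolding k by (simp add: algebra_simps)
    then show "[(r - e * c) * 1 + c * k = x] (mod (3 * q))"
      unfolding t using cong_3q[OF that] cong_add_lcancel by metis
  qed
  have t3: "t mod 3 = 0 \<or> t mod 3 = 1 \<or> t mod 3 = 2" by presburger
  show ?thesis
  proof (cases "\<bar>r\<bar> \<le> 1")
    case True
    have "\<exists>c. [c = t] (mod 3) \<and> \<bar>c\<bar> \<le> 1"
      using t3 by (elim disjE) (rule exI[of _ 0] exI[of _ 1] exI[of _ "-1"], simp add: cong_def)+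
    then obtain c where c: "[c = t] (mod 3)" "\<bar>c\<bar> \<le> 1" by blast
    then have "\<bar>r - e * c\<bar> \<le> \<bar>r\<bar> + 1" using e by auto
    then show ?thesis using bound[OF c(1)] c(2) q True by (auto split: if_splits)
  next
    case False
    \<comment> \<open>The sign \<open>s\<close> makes \<open>e * c\<close> point in the direction of
      \<open>r\<close>, so each inner step saves an outer one and the cost is at most
      \<open>\<bar>r\<bar> + 2\<close>.\<close>
    define s where "s = (if r > 0 then e else - e)"
    have s: "s = 1 \<or> s = - 1" using e by (auto simp: s_def)
    have "\<exists>j. [s * j = t] (mod 3) \<and> 0 \<le> j \<and> j \<le> 2"
      using s by (intro exI[of _ "(s * t) mod 3"]) (auto simp: cong_def mod_simps)
    then obtain j where j: "[s * j = t] (mod 3)" "0 \<le> j" "j \<le> 2" by blast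
    have "\<bar>r - e * (s * j)\<bar> = \<bar>r\<bar> - j" "\<bar>s * j\<bar> = j"
      using False e j by (auto simp: s_def)
    then show ?thesis using bound[OF j(1)] r by (auto split: if_splits)
  qed
qed

text \<open>If an optimal inner walk has \<open>e * a + b = res x\<close>, exchanging its
  coefficients is free. Otherwise it is long enough for \<open>outer_dist_le\<close>, unless
  \<open>b = 0\<close>, where the outer rim alone reaches \<open>reflect x\<close> in at most
  \<open>\<bar>a\<bar>\<close> steps.\<close>

lemma reflect_dist_le: "same_rim_dist (3 * q) 1 k (reflect x) \<le> same_rim_dist (3 * q) k 1 x"
proof -
  obtain a b where ab: "[a * k + b * 1 = x] (mod (3 * q))"
    "int (same_rim_dist (3 * q) k 1 x) = \<bar>a\<bar> + \<bar>b\<bar> + (if b = 0 then 0 else 2)"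
    using same_rim_dist_attained[of k 1 x "3 * q"] by auto
  have s: "[e * a + b = res x] (mod q)" and f: "[reflect x = res x + e * q * b] (mod (3 * q))"
    using ab(1) rim_rep_cong_q reflect_rep by auto
  consider "b = 0" | "b \<noteq> 0" "e * a + b = res x" | "b \<noteq> 0" "q - \<bar>res x\<bar> \<le> \<bar>e * a + b\<bar>"
    using abs_le_of_cong_least[OF s res_least] by blast
  then show ?thesis
  proof cases
    case 1
    then have "[res x * 1 + 0 * k = reflect x] (mod (3 * q))" using f cong_sym by simp
    from same_rim_dist_le[OF this] have "int (same_rim_dist (3 * q) 1 k (reflect x)) \<le> \<bar>res x\<bar>" by simp
    also have "\<dots> \<le> \<bar>e * a + b\<bar>" using abs_le_of_cong_least[OF s res_least] res_least[of x] by auto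
    finally show ?thesis using ab(2) 1 e by auto
  next
    case 2
    have "e * a + (e * b) * k = e * a + b + e * q * b"
      unfolding k by (simp add: algebra_simps ee)
    then have "[(e * a) * 1 + (e * b) * k = reflect x] (mod (3 * q))" using f 2(2) cong_sym by simp
    from same_rim_dist_le[OF this] show ?thesis using ab(2) 2(1) e by auto
  next
    case 3
    have "[reflect x = res x] (mod q)" using res_cong[of "reflect x"] res_reflect by (simp add: cong_sym)
    from outer_dist_le[OF res_least this] show ?thesis using 3 ab(2) e by (auto split: if_splits)
  qed
qed

lemma reflect_dist_less:
  "\<exists>x \<in> {0..<3 * q}. same_rim_dist (3 * q) 1 k (reflect x) < same_rim_dist (3 * q) k 1 x"
proof -
  \<comment> \<open>At the largest least residue \<open>r\<close>, going backwards from 0 to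
    \<open>r - q\<close> without spokes costs \<open>q - r\<close>, which is at most
    \<open>r + 1\<close>.\<close>
  define r where "r = q div 2"
  have r: "0 \<le> r" "2 * r \<le> q" "q \<le> 2 * r + 1" using q by (auto simp: r_def)
  have res: "res (r + 2 * q) = r"
  proof -
    have "res (r + 2 * q) = res r" by (rule res_eq) (simp add: cong_def)
    also have "\<dots> = r" using r q unfolding res_def by (subst mod_pos_pos_trivial) linarith+
    finally show ?thesis .
  qed
  define x where "x = reflect (r + 2 * q)"
  have x: "x \<in> {0..<3 * q}" using q by (simp add: x_def reflect_def)
  have fx: "reflect x = r + 2 * q" unfolding x_def using reflect_reflect r q by simp
  have rx: "res x = r" unfolding x_def res_reflect by (rule res)
  have "[(r - q) * 1 + 0 * k = reflect x] (mod (3 * q))" unfolding fx cong_iff_dvd_diff by simp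
  from same_rim_dist_le[OF this] have "int (same_rim_dist (3 * q) 1 k (reflect x)) \<le> q - r" using r q by simp
  also have "\<dots> < r + 2" using r by simp
  also have "\<dots> \<le> int (same_rim_dist (3 * q) k 1 x)"
  proof -
    obtain a b where ab: "[a * k + b * 1 = x] (mod (3 * q))"
      "int (same_rim_dist (3 * q) k 1 x) = \<bar>a\<bar> + \<bar>b\<bar> + (if b = 0 then 0 else 2)"
      using same_rim_dist_attained[of k 1 x "3 * q"] by auto
    have s: "[e * a + b = r] (mod q)" and f: "[reflect x = r + e * q * b] (mod (3 * q))"
      using ab(1) rim_rep_cong_q reflect_rep rx by auto
    \<comment> \<open>The point was chosen with \<open>q\<close>-coefficient 2, which is nonzero
      modulo 3. This forces the inner walk to use spokes, at total cost at least
      \<open>r + 2\<close>.\<close>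
    have "b \<noteq> 0"
    proof
      assume "b = 0"
      then have "3 * q dvd 2 * q" using f unfolding fx cong_iff_dvd_diff by simp
      then show False using zdvd_imp_le[of "3 * q" "2 * q"] q by linarith
    qed
    moreover have "r \<le> \<bar>e * a + b\<bar>" using abs_le_of_cong_least[OF s] r by auto
    ultimately show ?thesis using ab(2) e by auto
  qed
  finally show ?thesis using x by auto
qed

lemma rim_spheres_neq: "\<exists>m. rim_sphere (3 * q) 1 k m \<noteq> rim_sphere (3 * q) k 1 m"
  using rim_spheres_neqI[OF bij_reflect reflect_dist_le] reflect_dist_less by (metis (no_types))

end

section \<open>The case n = 9m\<close>

text \<open>
  Multiplication by \<open>k = 3 m - 1\<close> modulo \<open>9 m\<close> sends \<open>a + b k\<close> to \<open>(a + s) k + (b + s)\<close> for every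
  \<open>s\<close> congruent to \<open>b\<close> modulo \<open>3\<close>.
\<close>

lemma diagonal_shift_cost_le:
  fixes a b :: int
  assumes "a \<noteq> 0 \<or> \<bar>b\<bar> \<noteq> 1"
  shows "\<exists>s. 3 dvd s - b \<and>
    \<bar>a + s\<bar> + \<bar>b + s\<bar> + (if b + s = 0 then 0 else 2) \<le> \<bar>a\<bar> + \<bar>b\<bar> + (if b = 0 then 0 else 2)"
proof -
  have pos: "\<exists>s. 3 dvd s - b \<and>
    \<bar>a + s\<bar> + \<bar>b + s\<bar> + (if b + s = 0 then 0 else 2) \<le> \<bar>a\<bar> + \<bar>b\<bar> + (if b = 0 then 0 else 2)"
    if m: "b mod 3 = 1" and ab: "a \<noteq> 0 \<or> \<bar>b\<bar> \<noteq> 1" for a b :: int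
  \<comment> \<open>For \<open>b\<close> congruent to 1 the candidates are \<open>s = 1\<close> and
    \<open>s = - 2\<close>. Shift 1 costs nothing extra if \<open>a\<close> or \<open>b\<close> is
    negative; otherwise shift -2 works, except at \<open>a = 0\<close>, \<open>b = 1\<close>. The
    spokes are already paid for since \<open>b\<close> is nonzero.\<close>
  proof (cases "b > 0 \<and> a \<ge> 0")
    case True
    have "b = 1 \<or> b \<ge> 4" using m True by presburger
    then have "\<bar>a - 2\<bar> + \<bar>b - 2\<bar> \<le> \<bar>a\<bar> + \<bar>b\<bar>" using True ab by auto
    moreover have "3 dvd - 2 - b" using m by presburger
    ultimately show ?thesis using True by (intro exI[of _ "- 2"]) auto
  next
    case False
    have "b \<ge> 1 \<or> b \<le> - 2" using m by presburger
    then have "\<bar>a + 1\<bar> + \<bar>b + 1\<bar> \<le> \<bar>a\<bar> + \<bar>b\<bar>" "b \<noteq> 0" using False by auto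
    moreover have "3 dvd 1 - b" using m by presburger
    ultimately show ?thesis by (intro exI[of _ 1]) auto
  qed
  have "b mod 3 = 0 \<or> b mod 3 = 1 \<or> (- b) mod 3 = 1" by presburger
  then consider "b mod 3 = 0" | "b mod 3 = 1" | "(- b) mod 3 = 1" by blast
  then show ?thesis
  proof cases
    case 1
    then have "3 dvd b" by presburger
    then show ?thesis by (intro exI[of _ 0]) simp
  next
    case 2
    then show ?thesis using pos assms by blast
  next
    case 3
    have "- a \<noteq> 0 \<or> \<bar>- b\<bar> \<noteq> 1" using assms by simp
    \<comment> \<open>The residue 2 is reduced to the residue 1 by negating \<open>a\<close>,
      \<open>b\<close> and \<open>s\<close>.\<close>
    from pos[OF 3 this] obtain s where s: "3 dvd s - - b" "\<bar>- a + s\<bar> + \<bar>- b + s\<bar> + (if - b + s = 0 then 0 else 2)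
      \<le> \<bar>- a\<bar> + \<bar>- b\<bar> + (if - b = 0 then 0 else 2)" by blast
    have "\<bar>a + - s\<bar> = \<bar>- a + s\<bar>" "\<bar>b + - s\<bar> = \<bar>- b + s\<bar>" "b + - s = 0 \<longleftrightarrow> - b + s = 0" by auto
    moreover have "3 dvd - s - b" using s(1) by presburger
    ultimately show ?thesis using s(2) by (intro exI[of _ "- s"] conjI) simp_all
  qed
qed

locale nine_fold_GP =
  fixes m k n :: int
  assumes m: "m \<ge> 1" and k: "k = 3 * m - 1" and n: "n = 9 * m"
begin

text \<open>The hypotheses exclude the walks with \<open>a = 0\<close> and
  \<open>\<bar>b\<bar> = 1\<close>, the ones for which the diagonal shift could cost more. The shift
  is correct because \<open>k * k - 1\<close> and \<open>k + 1\<close> are both \<open>3 * m\<close>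
  modulo \<open>n\<close>.\<close>

lemma inner_dist_le:
  assumes "\<not> [x = k] (mod n)" "\<not> [x = - k] (mod n)"
  shows "same_rim_dist n k 1 (k * x) \<le> same_rim_dist n 1 k x"
proof -
  obtain a b where ab: "[a * 1 + b * k = x] (mod n)"
    "int (same_rim_dist n 1 k x) = \<bar>a\<bar> + \<bar>b\<bar> + (if b = 0 then 0 else 2)"
    using same_rim_dist_attained[of 1 k x n] by auto
  have "a \<noteq> 0 \<or> \<bar>b\<bar> \<noteq> 1" using ab(1) assms by (auto simp: abs_if cong_sym_eq split: if_splits)
  then obtain s where s: "3 dvd s - b" "\<bar>a + s\<bar> + \<bar>b + s\<bar> + (if b + s = 0 then 0 else 2)
      \<le> \<bar>a\<bar> + \<bar>b\<bar> + (if b = 0 then 0 else 2)" using diagonal_shift_cost_le by blast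
  obtain t where t: "s = b + 3 * t" using s(1) by (metis dvd_def add.commute diff_add_cancel)
  have "(a + s) * k + (b + s) * 1 - k * (a * 1 + b * k) = n * (b + t - m * b)"
    unfolding t k n by (simp add: algebra_simps)
  then have "[(a + s) * k + (b + s) * 1 = k * (a * 1 + b * k)] (mod n)" unfolding cong_iff_dvd_diff by simp
  also have "[k * (a * 1 + b * k) = k * x] (mod n)" using ab(1) by (rule cong_scalar_left)
  finally show ?thesis using same_rim_dist_le[of "a + s" k "b + s" 1 "k * x" n] s(2) ab(2) by simp
qed

text \<open>Since \<open>k + 1 = 3 * m\<close>, its square vanishes modulo \<open>n\<close>, so
  \<open>k * (k + 2)\<close> is -1.\<close>

lemma inverse: "[k * (- (k + 2)) = 1] (mod n)"
proof -
  have "k * (- (k + 2)) - 1 = n * (- m)" unfolding k n by (simp add: algebra_simps)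
  then show ?thesis unfolding cong_iff_dvd_diff by simp
qed

lemma mult_k_cancel:
  assumes "[k * x = k * y] (mod n)"
  shows "[x = y] (mod n)"
proof -
  have *: "[k * (- (k + 2)) * z = z] (mod n)" for z using cong_scalar_right[OF inverse, of z] by simp
  have "[- (k + 2) * (k * x) = - (k + 2) * (k * y)] (mod n)" using assms by (rule cong_scalar_left)
  then have "[k * (- (k + 2)) * x = k * (- (k + 2)) * y] (mod n)" by (metis mult.assoc mult.commute)
  then show ?thesis using *[of x] *[of y] by (metis cong_trans cong_sym)
qed

text \<open>The same diagonal shift works in the opposite direction, since \<open>k\<close> is -1
  modulo 3.\<close>

lemma outer_dist_le:
  assumes "\<not> [k * x = 1] (mod n)" "\<not> [k * x = - 1] (mod n)"
  shows "same_rim_dist n 1 k x \<le> same_rim_dist n k 1 (k * x)"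
proof -
  obtain a b where ab: "[a * k + b * 1 = k * x] (mod n)"
    "int (same_rim_dist n k 1 (k * x)) = \<bar>a\<bar> + \<bar>b\<bar> + (if b = 0 then 0 else 2)"
    using same_rim_dist_attained[of k 1 "k * x" n] by auto
  have "a \<noteq> 0 \<or> \<bar>b\<bar> \<noteq> 1" using ab(1) assms by (auto simp: abs_if cong_sym_eq split: if_splits)
  then obtain s where s: "3 dvd s - b" "\<bar>a + s\<bar> + \<bar>b + s\<bar> + (if b + s = 0 then 0 else 2)
      \<le> \<bar>a\<bar> + \<bar>b\<bar> + (if b = 0 then 0 else 2)" using diagonal_shift_cost_le by blast
  obtain t where t: "s = b + 3 * t" using s(1) by (metis dvd_def add.commute diff_add_cancel)
  have "k * ((a + s) * 1 + (b + s) * k) - (a * k + b * 1) = n * (2 * m * b - b + 3 * m * t - t)"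
    unfolding t k n by (simp add: algebra_simps)
  then have "[k * ((a + s) * 1 + (b + s) * k) = a * k + b * 1] (mod n)" unfolding cong_iff_dvd_diff by simp
  from mult_k_cancel[OF cong_trans[OF this ab(1)]] have "[(a + s) * 1 + (b + s) * k = x] (mod n)" .
  from same_rim_dist_le[OF this] show ?thesis using s(2) ab(2) by simp
qed

text \<open>Modulo \<open>3 * m\<close> the step \<open>k\<close> is -1. For small coefficients this
  congruence becomes an equation.\<close>

lemma rep_dvd:
  assumes "[a * 1 + b * k = x] (mod n)"
  shows "3 * m dvd a - b - x"
proof -
  have "3 * m dvd a * 1 + b * k - x"
    using assms unfolding cong_iff_dvd_diff n by (rule dvd_trans[rotated]) simp
  moreover have "a - b - x = a * 1 + b * k - x - 3 * m * b" unfolding k by (simp add: algebra_simps)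
  ultimately show ?thesis by (metis dvd_diff dvd_triv_left)
qed

lemma small_multiple:
  assumes "3 * m dvd y" "\<bar>y\<bar> < 3 * m"
  shows "y = 0"
  using assms dvd_imp_le_int[of y "3 * m"] by fastforce

lemma not_n_dvd: "\<not> n dvd 3 * m" "\<not> n dvd - (3 * m)"
  using m unfolding n by (auto dest: zdvd_imp_le)

lemma outer_dist_k:
  assumes "m \<ge> 2"
  shows "same_rim_dist n 1 k k = 3"
proof -
  obtain a b where ab: "[a * 1 + b * k = k] (mod n)"
    "int (same_rim_dist n 1 k k) = \<bar>a\<bar> + \<bar>b\<bar> + (if b = 0 then 0 else 2)"
    using same_rim_dist_attained[of 1 k k n] by auto
  have "int (same_rim_dist n 1 k k) \<ge> 3"
  proof (rule ccontr)
    assume small: "\<not> ?thesis"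
    \<comment> \<open>A walk using the other rim costs at least 3, so a shorter one has no
      spokes.\<close>
    then have b: "b = 0" "\<bar>a\<bar> \<le> 2" using ab(2) by (auto split: if_splits)
    have "3 * m dvd a + 1 - 3 * m" using rep_dvd[OF ab(1)] b k by (simp add: algebra_simps)
    then have "3 * m dvd a + 1" using dvd_add_right_iff[of "3 * m" "- (3 * m)" "a + 1"] by simp
    then have "a + 1 = 0" by (rule small_multiple) (use b assms in arith)
    then have "a = - 1" by simp
    then show False using ab(1) b not_n_dvd unfolding cong_iff_dvd_diff k by simp
  qed
  moreover have "int (same_rim_dist n 1 k k) \<le> 3" using same_rim_dist_le[of 0 1 1 k k n] by simp
  ultimately show ?thesis by simp
qed

lemma inner_dist_1:
  assumes "m \<ge> 2"
  shows "same_rim_dist n k 1 1 = 3"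
proof -
  obtain a b where ab: "[a * k + b * 1 = 1] (mod n)"
    "int (same_rim_dist n k 1 1) = \<bar>a\<bar> + \<bar>b\<bar> + (if b = 0 then 0 else 2)"
    using same_rim_dist_attained[of k 1 1 n] by auto
  have "int (same_rim_dist n k 1 1) \<ge> 3"
  proof (rule ccontr)
    assume small: "\<not> ?thesis"
    then have b: "b = 0" "\<bar>a\<bar> \<le> 2" using ab(2) by (auto split: if_splits)
    have "3 * m dvd - a - 1" using rep_dvd[of b a 1] ab(1) b by (simp add: add.commute)
    then have "a = - 1" using small_multiple[of "- a - 1"] b assms by simp
    then show False using ab(1) b not_n_dvd unfolding cong_iff_dvd_diff k by simp
  qed
  moreover have "int (same_rim_dist n k 1 1) \<le> 3" using same_rim_dist_le[of 0 k 1 1 1 n] by simp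
  ultimately show ?thesis by simp
qed

text \<open>Reduction modulo \<open>3 * m\<close> gives \<open>a = b + 1\<close>; the full
  congruence then makes \<open>b\<close> congruent to 1 modulo 3, and the size bound leaves two
  values.\<close>

lemma rep_k_plus_2:
  assumes "m \<ge> 2" "[a * 1 + b * k = k + 2] (mod n)" "\<bar>a\<bar> + \<bar>b\<bar> \<le> 4"
  shows "(a = 2 \<and> b = 1) \<or> (a = - 1 \<and> b = - 2)"
proof -
  have "3 * m dvd (a - b - 1) - 3 * m" using rep_dvd[OF assms(2)] k by (simp add: algebra_simps)
  then have "3 * m dvd a - b - 1" using dvd_add_right_iff[of "3 * m" "- (3 * m)" "a - b - 1"] by simp
  then have "a - b - 1 = 0" by (rule small_multiple) (use assms(1,3) in arith)
  then have a: "a = b + 1" by simp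
  have "9 * m dvd 3 * m * (b - 1)" using assms(2) unfolding cong_iff_dvd_diff a k n by (simp add: algebra_simps)
  then obtain t where "3 * m * (b - 1) = 3 * m * (3 * t)" by (auto elim: dvdE)
  then have "b = 1 + 3 * t" using m by (simp only: mult_cancel_left) auto
  moreover from this have "t = 0 \<or> t = - 1" using a assms(3) by arith
  ultimately show ?thesis using a by auto
qed

text \<open>Both short representations have \<open>\<bar>a\<bar> + \<bar>b\<bar> = 3\<close> and
  nonzero coefficients, so two spokes are added whichever rim is the starting one.\<close>

lemma dist_k_plus_2:
  assumes "m \<ge> 2"
  shows "same_rim_dist n 1 k (k + 2) = 5" "same_rim_dist n k 1 (k + 2) = 5"
proof -
  obtain a b where ab: "[a * 1 + b * k = k + 2] (mod n)"
    "int (same_rim_dist n 1 k (k + 2)) = \<bar>a\<bar> + \<bar>b\<bar> + (if b = 0 then 0 else 2)"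
    using same_rim_dist_attained[of 1 k "k + 2" n] by auto
  have "int (same_rim_dist n 1 k (k + 2)) \<ge> 5"
    using ab(2) rep_k_plus_2[OF assms ab(1)] by (cases "\<bar>a\<bar> + \<bar>b\<bar> \<le> 4") auto
  moreover have "int (same_rim_dist n 1 k (k + 2)) \<le> 5"
    using same_rim_dist_le[of 2 1 1 k "k + 2" n] by (simp add: add.commute)
  ultimately show "same_rim_dist n 1 k (k + 2) = 5" by simp
  obtain a b where ab: "[a * k + b * 1 = k + 2] (mod n)"
    "int (same_rim_dist n k 1 (k + 2)) = \<bar>a\<bar> + \<bar>b\<bar> + (if b = 0 then 0 else 2)"
    using same_rim_dist_attained[of k 1 "k + 2" n] by auto
  have "[b * 1 + a * k = k + 2] (mod n)" using ab(1) by (simp add: add.commute)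
  then have "int (same_rim_dist n k 1 (k + 2)) \<ge> 5"
    using ab(2) rep_k_plus_2[OF assms, of b a] by (cases "\<bar>b\<bar> + \<bar>a\<bar> \<le> 4") auto
  moreover have "int (same_rim_dist n k 1 (k + 2)) \<le> 5"
    using same_rim_dist_le[of 1 k 2 1 "k + 2" n] by simp
  ultimately show "same_rim_dist n k 1 (k + 2) = 5" by simp
qed

lemma k_squared: "[k * k = k + 2] (mod n)"
proof -
  have "k * k - (k + 2) = n * (m - 1)" unfolding k n by (simp add: algebra_simps)
  then show ?thesis unfolding cong_iff_dvd_diff by simp
qed

text \<open>The outer distances of \<open>k\<close> and \<open>k + 2\<close> are 3 and 5, while the
  inner distances of \<open>k * k\<close> and \<open>k * (k + 2)\<close> are 5 and 3. The involution
  \<open>\<tau>\<close> exchanges these points and their negatives accordingly before multiplication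
  by \<open>k\<close>.\<close>

lemma rim_sphere_eq:
  assumes m2: "m \<ge> 2"
  shows "rim_sphere n 1 k j = rim_sphere n k 1 j"
proof -
  define \<tau> where "\<tau> x = (if x = k then n - k - 2 else if x = n - k - 2 then k
    else if x = n - k then k + 2 else if x = k + 2 then n - k else x)" for x
  have "\<tau> (\<tau> x) = x" for x unfolding \<tau>_def k n using m2 by auto
  moreover have "\<tau> x \<in> {0..<n}" if "x \<in> {0..<n}" for x
    using that m2 unfolding \<tau>_def k n by auto
  ultimately have "bij_betw \<tau> {0..<n} {0..<n}" by (intro bij_betw_byWitness[of _ \<tau>]) auto
  from bij_betw_trans[OF this bij_betw_mult_mod[OF _ inverse]]
  have bij: "bij_betw (\<lambda>x. k * \<tau> x mod n) {0..<n} {0..<n}" using m2 n by (simp add: comp_def)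
  have dist_mod: "same_rim_dist n p q (x mod n) = same_rim_dist n p q x" for p q x
    by (rule rim_dist_cong) simp
  have inv_neg: "[k * (k + 2) = - 1] (mod n)"
    using inverse by (metis cong_minus_minus_iff minus_mult_right minus_minus)
  have special: "same_rim_dist n k 1 (k * (n - k - 2)) = 3" "same_rim_dist n k 1 (k * k) = 5"
    "same_rim_dist n k 1 (k * (k + 2)) = 3" "same_rim_dist n k 1 (k * (n - k)) = 5"
  proof -
    have neg: "[k * (n - y) = - (k * y)] (mod n)" for y
      by (simp add: cong_iff_dvd_diff algebra_simps)
    have one: "same_rim_dist n k 1 (k * (k + 2)) = 3"
      using rim_dist_cong(1)[OF inv_neg, of k 1] same_rim_dist_uminus[of k 1 n 1] inner_dist_1[OF m2] by simp
    then show "same_rim_dist n k 1 (k * (k + 2)) = 3" .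
    show "same_rim_dist n k 1 (k * (n - k - 2)) = 3"
      using rim_dist_cong(1)[OF neg[of "k + 2"], of k 1] same_rim_dist_uminus[of k 1 n "k * (k + 2)"] one
      by (simp add: algebra_simps)
    have two: "same_rim_dist n k 1 (k * k) = 5"
      using rim_dist_cong(1)[OF k_squared, of k 1] dist_k_plus_2(2)[OF m2] by simp
    then show "same_rim_dist n k 1 (k * k) = 5" .
    show "same_rim_dist n k 1 (k * (n - k)) = 5"
      using rim_dist_cong(1)[OF neg[of k], of k 1] same_rim_dist_uminus[of k 1 n "k * k"] two by simp
  qed
  have special': "same_rim_dist n 1 k (n - k - 2) = 5" "same_rim_dist n 1 k (n - k) = 3"
  proof -
    have neg: "[n - y = - y] (mod n)" for y by (simp add: cong_iff_dvd_diff)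
    show "same_rim_dist n 1 k (n - k - 2) = 5"
      using rim_dist_cong(1)[OF neg[of "k + 2"], of 1 k] same_rim_dist_uminus[of 1 k n "k + 2"] dist_k_plus_2(1)[OF m2]
      by (simp add: algebra_simps)
    show "same_rim_dist n 1 k (n - k) = 3"
      using rim_dist_cong(1)[OF neg[of k], of 1 k] same_rim_dist_uminus[of 1 k n k] outer_dist_k[OF m2] by simp
  qed
  show ?thesis
  proof (rule rim_sphere_eqI[OF bij])
    fix x assume x: "x \<in> {0..<n}"
    show "same_rim_dist n k 1 (k * \<tau> x mod n) = same_rim_dist n 1 k x"
    proof (cases "x = k \<or> x = n - k - 2 \<or> x = n - k \<or> x = k + 2")
      case True
      have "n - k - 2 \<noteq> k" "n - k \<noteq> k" "k + 2 \<noteq> k" "n - k \<noteq> n - k - 2" "k + 2 \<noteq> n - k - 2" "k + 2 \<noteq> n - k"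
        unfolding k n using m2 by auto
      then show ?thesis
        using True special special' outer_dist_k[OF m2] dist_k_plus_2(1)[OF m2]
        unfolding dist_mod \<tau>_def by (elim disjE) simp_all
    next
      case False
      then have \<tau>: "\<tau> x = x" by (simp add: \<tau>_def)
      have distinct: "\<not> [x = y] (mod n)" if "y \<in> {0..<n}" "x \<noteq> y" for y
        using that x by (auto simp: cong_def)
      have "k \<in> {0..<n}" "n - k - 2 \<in> {0..<n}" "n - k \<in> {0..<n}" "k + 2 \<in> {0..<n}"
        unfolding k n using m2 by auto
      then have ne: "\<not> [x = k] (mod n)" "\<not> [x = n - k - 2] (mod n)" "\<not> [x = n - k] (mod n)" "\<not> [x = k + 2] (mod n)"
        using distinct False by blast+
      have "\<not> [x = - k] (mod n)" using ne(3) by (simp add: cong_def mod_diff_left_eq[symmetric])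
      then have "same_rim_dist n k 1 (k * x) \<le> same_rim_dist n 1 k x" using ne(1) by (intro inner_dist_le)
      \<comment> \<open>As the inverse of \<open>k\<close> is \<open>- (k + 2)\<close>, the points
        excluded by \<open>outer_dist_le\<close> are \<open>k + 2\<close> and its negative.\<close>
      moreover have "\<not> [k * x = 1] (mod n)"
      proof
        assume "[k * x = 1] (mod n)"
        then have "[k * x = k * (- (k + 2))] (mod n)" using inverse by (metis cong_trans cong_sym)
        then have "[x = - (k + 2)] (mod n)" by (rule mult_k_cancel)
        moreover have "[- (k + 2) = n - k - 2] (mod n)" by (simp add: cong_iff_dvd_diff)
        ultimately show False using ne(2) cong_trans by blast
      qed
      moreover have "\<not> [k * x = - 1] (mod n)"
      proof
        assume "[k * x = - 1] (mod n)"
        then have "[k * x = k * (k + 2)] (mod n)" using inv_neg by (metis cong_trans cong_sym)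
        then show False using mult_k_cancel ne(4) by blast
      qed
      ultimately have "same_rim_dist n k 1 (k * x) = same_rim_dist n 1 k x"
        using outer_dist_le by (simp add: le_antisym)
      then show ?thesis unfolding dist_mod \<tau> .
    qed
  qed
qed

end

section \<open>The theorem\<close>

lemma graph_isoI:
  assumes wf: "wf_digraph (with_proj G)" and inj: "inj_on f (pverts G)"
    and verts: "pverts H = f ` pverts G" and arcs: "parcs H = map_prod f f ` parcs G"
  shows "graph_iso G H"
proof -
  let ?h = "\<lparr>iso_verts = f, iso_arcs = map_prod f f, iso_head = snd, iso_tail = fst\<rparr>"
  interpret wf_digraph "with_proj G" by (rule wf)
  have "inj_on (map_prod f f) (pverts G \<times> pverts G)" using inj by (simp add: map_prod_inj_on)
  moreover have "parcs G \<subseteq> pverts G \<times> pverts G" using wellformed by fastforce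
  ultimately have "inj_on (map_prod f f) (parcs G)" by (rule inj_on_subset)
  then have "pre_digraph.digraph_isomorphism (with_proj G) ?h"
    using wf inj by (simp add: pre_digraph.digraph_isomorphism_def)
  moreover have "with_proj H = app_iso ?h (with_proj G)"
    using verts arcs by (simp add: app_iso_def with_proj_def)
  ultimately show ?thesis unfolding graph_iso_def digraph_iso_def by blast
qed

lemma graph_iso_GP_refl:
  assumes "2 \<le> n" "0 < k" "k < n"
  shows "graph_iso (GP n k) (GP n k)"
proof -
  interpret pair_graph "GP n k" using pair_graph_GP assms by blast
  show ?thesis
  proof (rule graph_isoI[of _ id])
    show "wf_digraph (with_proj (GP n k))" by unfold_locales
  qed (simp_all add: map_prod.id)
qed

text \<open>Doubling and exchanging the rims sends step 1 to 2 and step 4 to 8, which is -1 modulo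
  9.\<close>

lemma graph_iso_GP_9_4_GP_9_2: "graph_iso (GP 9 4) (GP 9 2)"
proof -
  interpret pair_graph "GP 9 4" by (rule pair_graph_GP) simp_all
  define f where "f x = (case x of U i \<Rightarrow> V (2 * i mod 9) | V i \<Rightarrow> U (2 * i mod 9))" for x
  have nine: "{..<9::nat} = {0, 1, 2, 3, 4, 5, 6, 7, 8}" by auto
  have arcs: "parcs (GP n k) =
      (\<Union>i\<in>{..<n}. {(U i, U ((i + 1) mod n)), (U ((i + 1) mod n), U i), (V i, V ((i + k) mod n)),
         (V ((i + k) mod n), V i), (U i, V i), (V i, U i)})" for n k
    by (auto simp: GP_def GP_edges_def)
  show ?thesis
  proof (rule graph_isoI[of _ f])
    show "wf_digraph (with_proj (GP 9 4))" by unfold_locales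
    show "inj_on f (pverts (GP 9 4))" unfolding verts_GP nine by (simp add: inj_on_def f_def)
    show "pverts (GP 9 2) = f ` pverts (GP 9 4)" unfolding verts_GP nine by (auto simp: f_def)
    have "parcs (GP 9 2) \<subseteq> map_prod f f ` parcs (GP 9 4)" "map_prod f f ` parcs (GP 9 4) \<subseteq> parcs (GP 9 2)"
      unfolding arcs nine by (simp_all add: f_def del: One_nat_def)
    then show "parcs (GP 9 2) = map_prod f f ` parcs (GP 9 4)" by blast
  qed
qed

text \<open>This is the case \<open>m = 1\<close> of the nine-fold family. Doubling still does not
  increase distances, but it is strict at 4: the outer distance of 4 is at least 4, while 8 is -1
  and has inner distance at most 3.\<close>

lemma rim_spheres_neq_9_2: "\<exists>m. rim_sphere 9 1 2 m \<noteq> rim_sphere 9 2 1 m"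
proof -
  interpret nine_fold_GP 1 2 9 by unfold_locales simp_all
  have le: "same_rim_dist 9 2 1 (2 * x) \<le> same_rim_dist 9 1 2 x" for x
  proof (cases "[x = 2] (mod 9) \<or> [x = - 2] (mod 9)")
    \<comment> \<open>The points 2 and -2, which \<open>inner_dist_le\<close> leaves out, now have a
      spokeless outer walk of length 2, matching two inner steps to their doubles.\<close>
    case True
    then obtain s where s: "[x = s * 2] (mod 9)" "s = 1 \<or> s = - 1"
      using that[of 1] that[of "- 1"] by auto
    have "[s * 2 * 2 + 0 * 1 = 2 * x] (mod 9)" using cong_scalar_left[OF s(1), of 2] by (simp add: cong_sym_eq mult.commute)
    from same_rim_dist_le[OF this] have "int (same_rim_dist 9 2 1 (2 * x)) \<le> 2" using s(2) by auto
    moreover have "int (same_rim_dist 9 1 2 x) \<ge> 2"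
    proof -
      obtain a b where ab: "[a * 1 + b * 2 = x] (mod 9)"
        "int (same_rim_dist 9 1 2 x) = \<bar>a\<bar> + \<bar>b\<bar> + (if b = 0 then 0 else 2)"
        using same_rim_dist_attained[of 1 2 x 9] by auto
      have "\<bar>a\<bar> \<ge> 2" if "b = 0"
      proof -
        have "[a = s * 2] (mod 9)" using ab(1) s(1) that by (metis cong_trans mult_1_right mult_zero_left add.right_neutral)
        then have "9 dvd a - s * 2" by (simp add: cong_iff_dvd_diff)
        then show ?thesis using s(2) by presburger
      qed
      then show ?thesis using ab(2) by auto
    qed
    ultimately show ?thesis by simp
  next
    case False
    then show ?thesis using inner_dist_le by blast
  qed
  have "[0 * 2 + (- 1) * 1 = 2 * 4] (mod 9 :: int)" by (simp add: cong_def)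
  from same_rim_dist_le[OF this] have "int (same_rim_dist 9 2 1 (2 * 4)) \<le> 3" by simp
  moreover have "int (same_rim_dist 9 1 2 4) \<ge> 4"
  proof -
    obtain a b where ab: "[a * 1 + b * 2 = 4] (mod 9)"
      "int (same_rim_dist 9 1 2 4) = \<bar>a\<bar> + \<bar>b\<bar> + (if b = 0 then 0 else 2)"
      using same_rim_dist_attained[of 1 2 4 9] by auto
    have "9 dvd a + b * 2 - 4" using ab(1) by (simp add: cong_iff_dvd_diff)
    then have "b = 0 \<Longrightarrow> \<bar>a\<bar> \<ge> 4" "\<not> (a = 0 \<and> \<bar>b\<bar> = 1)" by presburger+
    then show ?thesis using ab(2) by auto
  qed
  ultimately have less: "same_rim_dist 9 2 1 (2 * 4) < same_rim_dist 9 1 2 4" by simp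
  have dist_mod: "same_rim_dist 9 2 1 (x mod 9) = same_rim_dist 9 2 1 x" for x
    by (rule rim_dist_cong) simp
  show ?thesis
  proof (rule rim_spheres_neqI)
    show "bij_betw (\<lambda>x. 2 * x mod 9) {0..<9::int} {0..<9}"
      by (rule bij_betw_mult_mod[of _ _ 5]) (simp_all add: cong_def)
    show "same_rim_dist 9 2 1 (2 * x mod 9) \<le> same_rim_dist 9 1 2 x" for x
      unfolding dist_mod by (rule le)
    show "same_rim_dist 9 2 1 (2 * 4 mod 9) < same_rim_dist 9 1 2 4"
      unfolding dist_mod by (rule less)
  qed simp
qed

lemma not_strongly_distance_balanced_GP_9_2: "\<not> strongly_distance_balanced (GP 9 2)"
  using strongly_distance_balanced_GP_iff[of 9 2] rim_spheres_neq_9_2 by simp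

text \<open>As \<open>4 * 2\<close> is -1 modulo 9, the rim counts of \<open>GP 9 4\<close> are
  those of \<open>GP 9 2\<close> exchanged.\<close>

lemma not_strongly_distance_balanced_GP_9_4: "\<not> strongly_distance_balanced (GP 9 4)"
proof -
  have "rim_sphere 9 1 4 m = rim_sphere 9 2 1 m" "rim_sphere 9 1 2 m = rim_sphere 9 4 1 m" for m
    by (rule rim_sphere_swap[of _ _ _ "- 1"]; simp add: cong_def)+
  then show ?thesis using strongly_distance_balanced_GP_iff[of 9 4] rim_spheres_neq_9_2 by auto
qed

section \<open>The balanced families and the final case distinction\<close>

lemma strongly_distance_balanced_GP_square_1:
  assumes "2 \<le> n" "0 < k" "k < n" "[int k * int k = 1] (mod int n)"
  shows "strongly_distance_balanced (GP n k)"
  using assms rim_sphere_swap[of "int n" "int k" "int k" 1] by (simp add: strongly_distance_balanced_GP_iff)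

lemma strongly_distance_balanced_GP_nine_fold:
  assumes "m \<ge> 2"
  shows "strongly_distance_balanced (GP (9 * m) (3 * m - 1))"
    and "strongly_distance_balanced (GP (9 * m) (3 * m + 1))"
proof -
  interpret nine_fold_GP "int m" "3 * int m - 1" "9 * int m"
    using assms by unfold_locales simp_all
  have eq: "rim_sphere (9 * int m) 1 (3 * int m - 1) j = rim_sphere (9 * int m) (3 * int m - 1) 1 j" for j
    using rim_sphere_eq assms by simp
  have "int (3 * m - 1) = 3 * int m - 1" using assms by simp
  then show "strongly_distance_balanced (GP (9 * m) (3 * m - 1))"
    using eq assms by (subst strongly_distance_balanced_GP_iff) auto
  have "(3 * int m + 1) * (3 * int m - 1) - (- 1) = 9 * int m * int m" by (simp add: algebra_simps)
  then have "[(3 * int m + 1) * (3 * int m - 1) = - 1] (mod 9 * int m)" unfolding cong_iff_dvd_diff by simp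
  then have "rim_sphere (9 * int m) 1 (3 * int m + 1) j = rim_sphere (9 * int m) (3 * int m - 1) 1 j"
    "rim_sphere (9 * int m) 1 (3 * int m - 1) j = rim_sphere (9 * int m) (3 * int m + 1) 1 j" for j
    using assms by (auto intro!: rim_sphere_swap[of _ _ _ "- 1"] simp: mult.commute)
  then show "strongly_distance_balanced (GP (9 * m) (3 * m + 1))"
    using eq assms by (subst strongly_distance_balanced_GP_iff) (auto simp: add.commute)
qed

theorem theorem4p7:
  fixes k :: nat
  assumes "k > 0"
  shows
    "([k = 0] (mod 3) \<longrightarrow> \<not> strongly_distance_balanced (GP (3 * k + 3) k)) \<and>
     ((\<not> [k = 0] (mod 3) \<longrightarrow>
         strongly_distance_balanced (GP (3 * k + 3) k) \<or>
         graph_iso (GP (3 * k + 3) k) (GP 9 2)) \<and>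
       \<not> strongly_distance_balanced (GP 9 2)) \<and>
     (k \<ge> 2 \<and> k \<noteq> 3 \<and> [k = 0] (mod 3) \<longrightarrow>
         \<not> strongly_distance_balanced (GP (3 * k - 3) k)) \<and>
     ((k \<ge> 2 \<and> \<not> [k = 0] (mod 3) \<longrightarrow>
         strongly_distance_balanced (GP (3 * k - 3) k) \<or>
         graph_iso (GP (3 * k - 3) k) (GP 9 4)) \<and>
       graph_iso (GP 9 4) (GP 9 2) \<and>
       \<not> strongly_distance_balanced (GP 9 4))"
proof (intro conjI impI)
  assume "[k = 0] (mod 3)"
  then have "3 dvd k" by (simp add: cong_0_iff)
  then have "k \<ge> 3" "3 dvd int k" using assms by (auto dest: dvd_imp_le)
  then interpret three_fold_GP "int k + 1" "- 1" "int k" by unfold_locales auto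
  have "int (3 * k + 3) = 3 * (int k + 1)" by simp
  then show "\<not> strongly_distance_balanced (GP (3 * k + 3) k)"
    using assms rim_spheres_neq by (subst strongly_distance_balanced_GP_iff) auto
next
  assume "\<not> [k = 0] (mod 3)"
  then have "k mod 3 = 1 \<or> k mod 3 = 2" unfolding cong_def by presburger
  then show "strongly_distance_balanced (GP (3 * k + 3) k) \<or> graph_iso (GP (3 * k + 3) k) (GP 9 2)"
  proof
    assume "k mod 3 = 1"
    then obtain t where t: "k = 3 * t + 1" by (metis mult_div_mod_eq)
    \<comment> \<open>Here \<open>n = 9 t + 6\<close> and
      \<open>k * k - 1 = 9 t * t + 6 t\<close>.\<close>
    have "int k * int k - 1 = int (3 * k + 3) * int t" unfolding t by (simp add: algebra_simps)
    then have "[int k * int k = 1] (mod int (3 * k + 3))" unfolding cong_iff_dvd_diff by simp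
    then show ?thesis using assms strongly_distance_balanced_GP_square_1 by auto
  next
    assume "k mod 3 = 2"
    then obtain m where m: "k = 3 * m - 1" "m \<ge> 1"
      by (intro that[of "k div 3 + 1"]) presburger+
    then have n: "3 * k + 3 = 9 * m" by simp
    show ?thesis
    proof (cases "m = 1")
      case True
      then show ?thesis unfolding m using graph_iso_GP_refl[of 9 2] by simp
    next
      case False
      then show ?thesis unfolding n unfolding m(1) using strongly_distance_balanced_GP_nine_fold(1)[of m] m(2) by simp
    qed
  qed
next
  assume k: "k \<ge> 2 \<and> k \<noteq> 3 \<and> [k = 0] (mod 3)"
  then obtain t where "k = 3 * t" by (auto simp: cong_0_iff)
  \<comment> \<open>Excluding \<open>k = 3\<close> makes the next multiple of 3 the smallest case,
    with \<open>q = 5\<close>.\<close>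
  then have "k \<ge> 6" "3 dvd int k" using k by auto
  then interpret three_fold_GP "int k - 1" 1 "int k" by unfold_locales auto
  have "int (3 * k - 3) = 3 * (int k - 1)" using \<open>k \<ge> 6\<close> by simp
  then show "\<not> strongly_distance_balanced (GP (3 * k - 3) k)"
    using rim_spheres_neq \<open>k \<ge> 6\<close> by (subst strongly_distance_balanced_GP_iff) auto
next
  assume k: "k \<ge> 2 \<and> \<not> [k = 0] (mod 3)"
  then have "k mod 3 = 2 \<or> k mod 3 = 1" unfolding cong_def by presburger
  then show "strongly_distance_balanced (GP (3 * k - 3) k) \<or> graph_iso (GP (3 * k - 3) k) (GP 9 4)"
  proof
    assume "k mod 3 = 2"
    then obtain t where t: "k = 3 * t + 2" by (metis mult_div_mod_eq)
    \<comment> \<open>Here \<open>n = 9 t + 3\<close>, and \<open>k * k - 1\<close> is the product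
      of \<open>k - 1 = 3 t + 1\<close> and \<open>k + 1 = 3 (t + 1)\<close>.\<close>
    have "int k * int k - 1 = int (3 * k - 3) * (int t + 1)" unfolding t by (simp add: algebra_simps)
    then have "[int k * int k = 1] (mod int (3 * k - 3))" unfolding cong_iff_dvd_diff by simp
    then show ?thesis using k strongly_distance_balanced_GP_square_1 by auto
  next
    assume "k mod 3 = 1"
    then obtain m where m: "k = 3 * m + 1" by (metis mult_div_mod_eq)
    then have n: "3 * k - 3 = 9 * m" "m \<ge> 1" using k by simp_all
    show ?thesis
    proof (cases "m = 1")
      case True
      then show ?thesis unfolding m using graph_iso_GP_refl[of 9 4] by simp
    next
      case False
      then show ?thesis unfolding n unfolding m using strongly_distance_balanced_GP_nine_fold(2)[of m] n(2) by simp
    qed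
  qed
qed (use not_strongly_distance_balanced_GP_9_2 graph_iso_GP_9_4_GP_9_2 not_strongly_distance_balanced_GP_9_4 in auto)

end
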